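(* Consider a sequence, indexed by the number $N$ of nodes, of closed Jackson networks with nodes $1,\dots,N$ (single-server nodes with finite capacities $c_{j,N}$ for $j\in\mathcal J_1^N$, infinite-server nodes with infinite capacities for $j\in\mathcal J_2^N$), with $M_N$ customers, utilizations $r_{j,N}$, stationary node-occupation vector $(\xi_{j,N})_{1\le j\le N}$, chemical potential $\gamma_N$, free variables $(\eta_{j,N})_{1\le j\le N}$ and variance $b_N^2$, all defined in the context. Assume that (1) there exists $C<+\infty$ such that $c_{j,N}\le C$ for all $N\ge1$ and $j\in\mathcal J_1^N$; (2) $\displaystyle\lim_{N\to\infty}b_N=+\infty$; (3) $K\ge1$ is an integer such that $\displaystyle\lim_{N\to\infty}b_N^{-1}\sum_{j\in\mathcal J_2^N\cap\{1,\dots,K\}}\gamma_N r_{j,N}=0$. Then for all $(n_1,\dots,n_K)\in\mathbb N^K$, $$\lim_{N\to\infty}\frac{\mathbb P(\xi_{1,N}=n_1,\dots,\xi_{K,N}=n_K)}{\mathbb P(\eta_{1,N}=n_1)\cdots\mathbb P(\eta_{K,N}=n_K)}=1,$$ where the ratio is read as $1$ for those $N$ for which $n_j>c_{j,N}$ for some $j\le K$ (numerator and denominator then both vanish).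
   Context: $\mathbb N=\{0,1,2,\dots\}$. For each $N$, $\{1,\dots,N\}$ is the disjoint union of two non-empty sets $\mathcal J_1^N$ and $\mathcal J_2^N$. Node $j$ has capacity $c_{j,N}\in\mathbb N$ if $j\in\mathcal J_1^N$ and $c_{j,N}=+\infty$ if $j\in\mathcal J_2^N$; $c_N=(c_{j,N})_{1\le j\le N}$. For an integer $L\ge0$, $$\mathcal S^{c_N}_{N,L}=\Big\{(n_1,\dots,n_N)\in\mathbb N^N:\sum_j n_j=L,\ n_j\le c_{j,N}\text{ for }j\in\mathcal J_1^N\Big\}.$$ Services at node $j$ are exponential with parameter $\mu_{j,N}>0$: $g_{j,N}(k)=\mu_{j,N}\mathbf 1_{\{k\ge1\}}$ for $j\in\mathcal J_1^N$ and $g_{j,N}(k)=\mu_{j,N}k$ for $j\in\mathcal J_2^N$. The occupation process is a Markov process on $\mathcal S^{c_N}_{N,M_N}$ following any one of these dynamics ($e_i$ denotes the $i$-th unit vector): (a) Blocking: $n\to n-e_i+e_j$ at rate $g_{i,N}(n_i)p_{ij,N}\mathbf 1_{\{n_j<c_{j,N}\}}$, where $P_N=(p_{ij,N})$ is an irreducible routing matrix, reversible with respect to its invariant probability vector $\theta_N$. (b) Blocking and rerouting: for $i\ne j$, $n\to n-e_i+e_j$ at rate $g_{i,N}(n_i)p^*_{ij,N}(n)$, where $p^*_{ij,N}(n)$ is the probability that a Markov chain with irreducible transition matrix $P_N$ started at $i$ enters the set $\{j: j=i\text{ or }n_j<c_{j,N}\}$ at $j$; $\theta_N$ is the invariant probability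 vector of $P_N$. (c) State-dependent routing: for $i\neq j$, $n\to n-e_i+e_j$ at rate $g_{i,N}(n_i)p_{ij,N}(n-e_i)\mathbf 1_{\{n_i>0,\,n_j<c_{j,N}\}}$, where for each $m\in\mathcal S^{c_N}_{N,M_N-1}$ a transition matrix $(p_{ij,N}(m))_{i,j\in A(m)}$ on $A(m)=\{j:m_j<c_{j,N}\}$ is given, and $\theta_N$ is a positive probability vector with $\sum_{i\in A(m)}\theta_{i,N}p_{ij,N}(m)=\theta_{j,N}$ for all such $m$ and all $j\in A(m)$. With $r_{j,N}=\mu_{j,N}^{-1}\theta_{j,N}$, in each case the stationary distribution considered, i.e. the law of $(\xi_{1,N},\dots,\xi_{N,N})$, is $$\mathbb P(\xi_{1,N}=n_1,\dots,\xi_{N,N}=n_N)=\frac1{Z_N}\prod_{j\in\mathcal J_1^N}r_{j,N}^{n_j}\prod_{j\in\mathcal J_2^N}\frac{r_{j,N}^{n_j}}{n_j!},\qquad (n_1,\dots,n_N)\in\mathcal S^{c_N}_{N,M_N},$$ with $Z_N$ the normalizing constant. $\gamma_N\in[0,+\infty)$ is the unique solution of $$\sum_{j\in\mathcal J_1^N}\frac{\sum_{n=0}^{c_{j,N}}n(\gamma_Nr_{j,N})^n}{\sum_{n=0}^{c_{j,N}}(\gamma_Nr_{j,N})^n}+\sum_{j\in\mathcal J_2^N}\gamma_Nr_{j,N}=M_N .$$ The free variables $\eta_{1,N},\dots,\eta_{N,N}$ are independent; for $j\in\mathcal J_1^N$, $\eta_{j,N}$ is truncated geometric: $\mathbb P(\eta_{j,N}=k)=(\gamma_Nr_{j,N})^k/\sum_{h=0}^{c_{j,N}}(\gamma_Nr_{j,N})^h$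 for $0\le k\le c_{j,N}$; for $j\in\mathcal J_2^N$, $\eta_{j,N}$ is Poisson with parameter $\gamma_Nr_{j,N}$. Finally $b_N\ge0$ and $b_N^2=\mathrm{Var}\big(\sum_{j=1}^N\eta_{j,N}\big)=\sum_{j=1}^N\mathrm{Var}(\eta_{j,N})$. *)

theory Defs
  imports "HOL-Probability.Probability" "HOL-Library.Extended_Nat"
begin

section \<open>Closed Jackson networks\<close>

record jackson_network =
  single_server :: "nat set"      \<comment> \<open>\<open>\<J>\<^sub>1\<close>\<close>
  infinite_server :: "nat set"    \<comment> \<open>\<open>\<J>\<^sub>2\<close>\<close>
  capacity :: "nat \<Rightarrow> enat"        \<comment> \<open>\<open>c\<^sub>j\<close>\<close>
  service_par :: "nat \<Rightarrow> real"     \<comment> \<open>\<open>\<mu>\<^sub>j\<close>\<close>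
  visit :: "nat \<Rightarrow> real"           \<comment> \<open>\<open>\<theta>\<^sub>j\<close>\<close>
  customers :: nat                \<comment> \<open>\<open>M\<close>\<close>

definition nodes :: "jackson_network \<Rightarrow> nat set" where
  "nodes net = single_server net \<union> infinite_server net"

definition network_on :: "nat \<Rightarrow> jackson_network \<Rightarrow> bool" where
  "network_on N net \<longleftrightarrow>
     nodes net = {1..N} \<and>
     single_server net \<inter> infinite_server net = {} \<and>
     single_server net \<noteq> {} \<and> infinite_server net \<noteq> {} \<and>
     (\<forall>j\<in>single_server net. capacity net j \<noteq> \<infinity>) \<and>
     (\<forall>j\<in>infinite_server net. capacity net j = \<infinity>) \<and>
     (\<forall>j\<in>nodes net. service_par net j > 0)"

text \<open>An element of \<open>\<nat>\<^sup>N\<close> is represented by a function that vanishes outside the nodes.\<close>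

definition states :: "jackson_network \<Rightarrow> nat \<Rightarrow> (nat \<Rightarrow> nat) set" where
  "states net L = {n. (\<forall>j. j \<notin> nodes net \<longrightarrow> n j = 0) \<and> (\<Sum>j\<in>nodes net. n j) = L \<and>
     (\<forall>j\<in>single_server net. enat (n j) \<le> capacity net j)}"

definition service_rate :: "jackson_network \<Rightarrow> nat \<Rightarrow> nat \<Rightarrow> real" where
  "service_rate net j k =
     (if j \<in> single_server net then service_par net j * of_bool (1 \<le> k)
      else service_par net j * real k)"


section \<open>Routing\<close>

definition transition_matrix :: "nat set \<Rightarrow> (nat \<Rightarrow> nat \<Rightarrow> real) \<Rightarrow> bool" where
  "transition_matrix V p \<longleftrightarrow>
     (\<forall>i\<in>V. \<forall>j\<in>V. p i j \<ge> 0) \<and> (\<forall>i\<in>V. (\<Sum>j\<in>V. p i j) = 1)"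

definition irreducible_matrix :: "nat set \<Rightarrow> (nat \<Rightarrow> nat \<Rightarrow> real) \<Rightarrow> bool" where
  "irreducible_matrix V p \<longleftrightarrow>
     (\<forall>i\<in>V. \<forall>j\<in>V. (i, j) \<in> {(k, l). k \<in> V \<and> l \<in> V \<and> p k l > 0}\<^sup>*)"

definition probability_vector :: "nat set \<Rightarrow> (nat \<Rightarrow> real) \<Rightarrow> bool" where
  "probability_vector V t \<longleftrightarrow> (\<forall>i\<in>V. t i \<ge> 0) \<and> (\<Sum>i\<in>V. t i) = 1"

definition invariant_vector :: "nat set \<Rightarrow> (nat \<Rightarrow> nat \<Rightarrow> real) \<Rightarrow> (nat \<Rightarrow> real) \<Rightarrow> bool" where
  "invariant_vector V p t \<longleftrightarrow> (\<forall>j\<in>V. (\<Sum>i\<in>V. t i * p i j) = t j)"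

definition reversible_wrt :: "nat set \<Rightarrow> (nat \<Rightarrow> nat \<Rightarrow> real) \<Rightarrow> (nat \<Rightarrow> real) \<Rightarrow> bool" where
  "reversible_wrt V p t \<longleftrightarrow> (\<forall>i\<in>V. \<forall>j\<in>V. t i * p i j = t j * p j i)"

text \<open>\<open>Q\<close> is the law, on the space of paths \<open>\<nat> \<rightarrow> V\<close>, of the Markov chain with transition
  matrix \<open>p\<close> started at \<open>i\<close>; it is uniquely determined by these cylinder probabilities.\<close>

definition markov_chain_law ::
    "nat set \<Rightarrow> (nat \<Rightarrow> nat \<Rightarrow> real) \<Rightarrow> nat \<Rightarrow> (nat \<Rightarrow> nat) measure \<Rightarrow> bool" where
  "markov_chain_law V p i Q \<longleftrightarrow>
     prob_space Q \<and>
     sets Q = sets (PiM UNIV (\<lambda>_::nat. count_space (UNIV :: nat set))) \<and>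
     (\<forall>k x. (\<forall>l\<le>k. x l \<in> V) \<longrightarrow>
        measure Q {\<omega> \<in> space Q. \<forall>l\<le>k. \<omega> l = x l} =
          of_bool (x 0 = i) * (\<Prod>l<k. p (x l) (x (Suc l))))"

text \<open>Probability that the chain enters \<open>B\<close> at \<open>j\<close>. Entrance takes place at a time \<open>\<ge> 1\<close>: in the
  rerouting dynamics the starting point itself belongs to \<open>B\<close>, and a customer leaving \<open>i\<close> is
  routed at least once (and stays at \<open>i\<close> if the chain returns there first).\<close>

definition entrance_prob :: "(nat \<Rightarrow> nat) measure \<Rightarrow> nat set \<Rightarrow> nat \<Rightarrow> real" where
  "entrance_prob Q B j =
     measure Q {\<omega> \<in> space Q. \<exists>k\<ge>1. \<omega> k \<in> B \<and> \<omega> k = j \<and> (\<forall>l\<in>{1..<k}. \<omega> l \<notin> B)}"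


section \<open>Dynamics\<close>

text \<open>\<open>n - e\<^sub>i\<close> and \<open>n - e\<^sub>i + e\<^sub>j\<close>; only meaningful when \<open>n i > 0\<close> (all rates below vanish otherwise).\<close>

definition remove :: "nat \<Rightarrow> (nat \<Rightarrow> nat) \<Rightarrow> (nat \<Rightarrow> nat)" where
  "remove i n = n(i := n i - 1)"

definition move :: "nat \<Rightarrow> nat \<Rightarrow> (nat \<Rightarrow> nat) \<Rightarrow> (nat \<Rightarrow> nat)" where
  "move i j n = (remove i n)(j := remove i n j + 1)"

definition nonfull :: "jackson_network \<Rightarrow> (nat \<Rightarrow> nat) \<Rightarrow> nat set" where
  "nonfull net m = {j \<in> nodes net. enat (m j) < capacity net j}"

text \<open>In the following three predicates \<open>w i j n\<close> is the rate of the jump \<open>n \<rightarrow> n - e\<^sub>i + e\<^sub>j\<close>. Jumps with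
  \<open>i = j\<close> do not change the state and are disregarded.\<close>

definition blocking ::
    "jackson_network \<Rightarrow> (nat \<Rightarrow> nat \<Rightarrow> (nat \<Rightarrow> nat) \<Rightarrow> real) \<Rightarrow> bool" where
  "blocking net w \<longleftrightarrow>
     (\<exists>p. transition_matrix (nodes net) p \<and> irreducible_matrix (nodes net) p \<and>
        probability_vector (nodes net) (visit net) \<and>
        invariant_vector (nodes net) p (visit net) \<and>
        reversible_wrt (nodes net) p (visit net) \<and>
        (\<forall>n\<in>states net (customers net). \<forall>i\<in>nodes net. \<forall>j\<in>nodes net. i \<noteq> j \<longrightarrow>
           w i j n = service_rate net i (n i) * p i j * of_bool (enat (n j) < capacity net j)))"

definition blocking_rerouting ::
    "jackson_network \<Rightarrow> (nat \<Rightarrow> nat \<Rightarrow> (nat \<Rightarrow> nat) \<Rightarrow> real) \<Rightarrow> bool" where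
  "blocking_rerouting net w \<longleftrightarrow>
     (\<exists>p Q. transition_matrix (nodes net) p \<and> irreducible_matrix (nodes net) p \<and>
        probability_vector (nodes net) (visit net) \<and>
        invariant_vector (nodes net) p (visit net) \<and>
        (\<forall>i\<in>nodes net. markov_chain_law (nodes net) p i (Q i)) \<and>
        (\<forall>n\<in>states net (customers net). \<forall>i\<in>nodes net. \<forall>j\<in>nodes net. i \<noteq> j \<longrightarrow>
           w i j n = service_rate net i (n i) * entrance_prob (Q i) (insert i (nonfull net n)) j))"

text \<open>Writing \<open>customers net = Suc L\<close> avoids truncated subtraction: there is no condition on the
  routing when there are no customers.\<close>

definition state_dependent_routing ::
    "jackson_network \<Rightarrow> (nat \<Rightarrow> nat \<Rightarrow> (nat \<Rightarrow> nat) \<Rightarrow> real) \<Rightarrow> bool" where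
  "state_dependent_routing net w \<longleftrightarrow>
     probability_vector (nodes net) (visit net) \<and> (\<forall>i\<in>nodes net. visit net i > 0) \<and>
     (\<exists>p :: (nat \<Rightarrow> nat) \<Rightarrow> nat \<Rightarrow> nat \<Rightarrow> real.
        (\<forall>L m. customers net = Suc L \<and> m \<in> states net L \<longrightarrow>
           transition_matrix (nonfull net m) (p m) \<and>
           invariant_vector (nonfull net m) (p m) (visit net)) \<and>
        (\<forall>n\<in>states net (customers net). \<forall>i\<in>nodes net. \<forall>j\<in>nodes net. i \<noteq> j \<longrightarrow>
           w i j n = service_rate net i (n i) * p (remove i n) i j *
             of_bool (n i > 0 \<and> enat (n j) < capacity net j)))"

definition transition_rate ::
    "jackson_network \<Rightarrow> (nat \<Rightarrow> nat \<Rightarrow> (nat \<Rightarrow> nat) \<Rightarrow> real) \<Rightarrow> (nat \<Rightarrow> nat) \<Rightarrow> (nat \<Rightarrow> nat) \<Rightarrow> real" where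
  "transition_rate net w n n' =
     (\<Sum>i\<in>nodes net. \<Sum>j\<in>nodes net - {i}. if n' = move i j n then w i j n else 0)"

text \<open>Stationarity (global balance) of a law \<open>\<pi>\<close> for the Markov jump process with these rates on
  the finite state space.\<close>

definition stationary_for ::
    "jackson_network \<Rightarrow> (nat \<Rightarrow> nat \<Rightarrow> (nat \<Rightarrow> nat) \<Rightarrow> real) \<Rightarrow> ((nat \<Rightarrow> nat) \<Rightarrow> real) \<Rightarrow> bool" where
  "stationary_for net w \<pi> \<longleftrightarrow>
     (\<forall>n\<in>states net (customers net).
        (\<Sum>n'\<in>states net (customers net) - {n}. \<pi> n * transition_rate net w n n') =
        (\<Sum>n'\<in>states net (customers net) - {n}. \<pi> n' * transition_rate net w n' n))"


section \<open>Stationary occupation vector, chemical potential and free variables\<close>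

definition utilization :: "jackson_network \<Rightarrow> nat \<Rightarrow> real" where
  "utilization net j = visit net j / service_par net j"

definition state_weight :: "jackson_network \<Rightarrow> (nat \<Rightarrow> nat) \<Rightarrow> real" where
  "state_weight net n =
     (\<Prod>j\<in>single_server net. utilization net j ^ n j) *
     (\<Prod>j\<in>infinite_server net. utilization net j ^ n j / fact (n j))"

definition partition_function :: "jackson_network \<Rightarrow> real" where
  "partition_function net = (\<Sum>n\<in>states net (customers net). state_weight net n)"

text \<open>The process need not be irreducible on its state space, so that stationarity alone may not
  determine the law; the stationary law considered is the one in product form.\<close>

definition stationary_occupation ::
    "jackson_network \<Rightarrow> (nat \<Rightarrow> nat \<Rightarrow> (nat \<Rightarrow> nat) \<Rightarrow> real) \<Rightarrow> 'a measure \<Rightarrow> (nat \<Rightarrow> 'a \<Rightarrow> nat) \<Rightarrow> bool" where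
  "stationary_occupation net w \<Omega> \<xi> \<longleftrightarrow>
     prob_space \<Omega> \<and>
     (\<forall>j\<in>nodes net. \<xi> j \<in> \<Omega> \<rightarrow>\<^sub>M count_space UNIV) \<and>
     stationary_for net w (\<lambda>n. measure \<Omega> {\<omega> \<in> space \<Omega>. \<forall>j\<in>nodes net. \<xi> j \<omega> = n j}) \<and>
     (\<forall>n\<in>states net (customers net).
        measure \<Omega> {\<omega> \<in> space \<Omega>. \<forall>j\<in>nodes net. \<xi> j \<omega> = n j} =
          state_weight net n / partition_function net)"

definition chemical_potential :: "jackson_network \<Rightarrow> real \<Rightarrow> bool" where
  "chemical_potential net \<gamma> \<longleftrightarrow>
     \<gamma> \<ge> 0 \<and>
     (\<Sum>j\<in>single_server net.
        (\<Sum>n\<in>{0..the_enat (capacity net j)}. real n * (\<gamma> * utilization net j) ^ n) /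
        (\<Sum>n\<in>{0..the_enat (capacity net j)}. (\<gamma> * utilization net j) ^ n)) +
     (\<Sum>j\<in>infinite_server net. \<gamma> * utilization net j) = real (customers net)"

text \<open>The Poisson law is written out since \<^const>\<open>poisson_pmf\<close> requires a positive parameter, while
  \<open>\<gamma> = 0\<close> occurs when there are no customers.\<close>

definition free_variables ::
    "jackson_network \<Rightarrow> real \<Rightarrow> 'b measure \<Rightarrow> (nat \<Rightarrow> 'b \<Rightarrow> nat) \<Rightarrow> bool" where
  "free_variables net \<gamma> \<Omega> \<eta> \<longleftrightarrow>
     prob_space \<Omega> \<and>
     prob_space.indep_vars \<Omega> (\<lambda>_. count_space UNIV) \<eta> (nodes net) \<and>
     (\<forall>j\<in>single_server net. \<forall>k. enat k \<le> capacity net j \<longrightarrow>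
        measure \<Omega> {\<omega> \<in> space \<Omega>. \<eta> j \<omega> = k} =
          (\<gamma> * utilization net j) ^ k /
          (\<Sum>h\<in>{0..the_enat (capacity net j)}. (\<gamma> * utilization net j) ^ h)) \<and>
     (\<forall>j\<in>infinite_server net. \<forall>k.
        measure \<Omega> {\<omega> \<in> space \<Omega>. \<eta> j \<omega> = k} =
          (\<gamma> * utilization net j) ^ k / fact k * exp (- (\<gamma> * utilization net j)))"

end

theory Submission
  imports Defs
begin

text \<open>Conditioning the free variables on their sum being \<open>M\<^sub>N\<close> gives the product-form law, so the ratio
  of the theorem equals \<open>P(S' = M\<^sub>N - m) / P(S = M\<^sub>N)\<close>, where \<open>S\<close> is the sum of all free variables,
  \<open>S'\<close> the sum over the nodes \<open>j > K\<close>, and \<open>m = n\<^sub>1 + \<dots> + n\<^sub>K\<close>. By Fourier inversion on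
  \<open>[-\<pi>, \<pi>]\<close> and dominated convergence, both probabilities multiplied by \<open>b\<^sub>N\<close> tend to
  \<open>1 / \<surd>(2\<pi>)\<close>. Bounded capacities make the characteristic function of each node decay like
  \<open>exp (- a \<sigma>\<^sup>2 t\<^sup>2)\<close> on the whole interval and differ from \<open>exp (- \<sigma>\<^sup>2 t\<^sup>2 / 2)\<close> by \<open>O(\<sigma>\<^sup>2 \<bar>t\<bar>\<^sup>3)\<close>,
  with constants that depend only on \<open>C\<close>. The integrands for \<open>S\<close> and \<open>S'\<close> differ by at most
  \<open>\<bar>t\<bar>\<close> times \<open>m\<close> plus the mean of the first \<open>K\<close> free variables, which is \<open>o(b\<^sub>N)\<close>.\<close>

section \<open>Fourier inversion and local limits\<close>

text \<open>The obstacle is arithmetic: a law concentrated on the even integers has a characteristic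
  function of modulus 1 at t = pi, and such laws obey a central limit theorem but not the local one.
  Truncated geometric weights exclude this quantitatively. The sum Q of the products
  \<open>p k * p (Suc k)\<close> of neighbouring weights dominates the variance up to the factor
  \<open>(C + 1) ^ 4\<close>, and (1 - cos t) Q is a lower bound for 1 minus the squared modulus of
  the characteristic function. Single nodes may have arbitrarily small variance, so every estimate
  is kept proportional to the variance instead of being normalised by it. The equation for
  \<open>\<gamma>\<close> says that S has mean exactly M, hence no phase survives at the target M.
  For S' no recentring is made: its integrand at u / b is compared with that of S, and for
  domination it suffices that at least half of the variance remains after removing K nodes. Targets
  are integers because M - m may be negative.\<close>

lemma CLBINT_iexp_int:
  fixes d :: int
  shows "(CLINT t:{-pi..pi}|lborel. iexp (t * real_of_int d)) = (if d = 0 then 2 * pi else 0)"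
proof (cases "d = 0")
  case True
  then show ?thesis by (simp add: set_lebesgue_integral_def scaleR_conv_of_real)
next
  case False
  let ?F = "\<lambda>t::real. iexp (t * real_of_int d) / (\<i> * of_int d)"
  have "(\<integral>t. indicator {-pi..pi} t *\<^sub>R iexp (t * real_of_int d) \<partial>lborel) = ?F pi - ?F (-pi)"
  proof (rule integral_FTC_Icc)
    show "(?F has_vector_derivative iexp (t * real_of_int d)) (at t within {-pi..pi})" for t
    proof -
      have "((\<lambda>z. exp (\<i> * (z * of_int d)) / (\<i> * of_int d)) has_field_derivative
          exp (\<i> * (of_real t * of_int d))) (at (of_real t))"
        using False by (auto intro!: derivative_eq_intros simp: field_simps)
      from has_vector_derivative_real_field[OF this, of "{-pi..pi}"] show ?thesis by simp
    qed
    show "continuous_on {-pi..pi} (\<lambda>t. iexp (t * real_of_int d))"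
      by (intro continuous_intros)
  qed simp
  also have "\<dots> = 0"
  proof -
    \<comment> \<open>The antiderivative takes equal values at both endpoints: \<open>cis\<close> of
      opposite angles are conjugate, and here both are real since sin (pi d) = 0.\<close>
    have "cis (- (pi * real_of_int d)) = cis (pi * real_of_int d)"
      using sin_npi_int[of d] by (simp add: complex_eq_iff mult.commute)
    then show ?thesis by (simp add: cis_conv_exp mult.commute)
  qed
  finally show ?thesis using False by (simp add: set_lebesgue_integral_def)
qed

text \<open>By Fubini the t-integral can be taken first, and orthogonality of the exponentials
  leaves 2 pi times the indicator of the event. For a negative target \<open>k\<close> both sides
  vanish.\<close>

lemma (in prob_space) Fourier_inversion_nat:
  fixes X :: "'a \<Rightarrow> nat" and k :: int
  assumes [measurable]: "X \<in> M \<rightarrow>\<^sub>M count_space UNIV"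
  shows "(CLINT t:{-pi..pi}|lborel. CLINT \<omega>|M. iexp (t * (real (X \<omega>) - real_of_int k))) =
    of_real (2 * pi * prob {\<omega> \<in> space M. int (X \<omega>) = k})"
proof -
  have fin: "emeasure (lborel \<Otimes>\<^sub>M M) ({-pi..pi} \<times> space M) < \<infinity>"
    by (subst emeasure_pair_measure_Times) (auto simp: emeasure_space_1)
  interpret pair_sigma_finite lborel M ..
  let ?f = "\<lambda>t \<omega>. indicator {-pi..pi} t *\<^sub>R iexp (t * (real (X \<omega>) - real_of_int k))"
  have meas [measurable]: "case_prod ?f \<in> borel_measurable (lborel \<Otimes>\<^sub>M M)"
    by measurable
  have int: "integrable (lborel \<Otimes>\<^sub>M M) (case_prod ?f)"
  proof (rule integrableI_bounded_set[where A = "{-pi..pi} \<times> space M" and B = 1])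
  qed (use fin in \<open>auto simp: indicator_def space_pair_measure split: prod.splits\<close>)
  have inner: "(\<integral>t. ?f t \<omega> \<partial>lborel) =
      complex_of_real (2 * pi * indicator {\<omega> \<in> space M. int (X \<omega>) = k} \<omega>)"
    if "\<omega> \<in> space M" for \<omega>
    using CLBINT_iexp_int[of "int (X \<omega>) - k"] that
    by (auto simp: set_lebesgue_integral_def indicator_def)
  have "(CLINT t:{-pi..pi}|lborel. CLINT \<omega>|M. iexp (t * (real (X \<omega>) - real_of_int k))) =
      (\<integral>t. \<integral>\<omega>. ?f t \<omega> \<partial>M \<partial>lborel)"
    by (simp add: set_lebesgue_integral_def)
  also have "\<dots> = (\<integral>\<omega>. \<integral>t. ?f t \<omega> \<partial>lborel \<partial>M)"
    by (rule Fubini_integral[OF int, symmetric])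
  also have "\<dots> = (\<integral>\<omega>. of_real (2 * pi * indicator {\<omega> \<in> space M. int (X \<omega>) = k} \<omega>) \<partial>M)"
    by (intro Bochner_Integration.integral_cong refl inner)
  also have "\<dots> = of_real (2 * pi * prob {\<omega> \<in> space M. int (X \<omega>) = k})"
    by (subst integral_complex_of_real) (simp add: Int_absorb1 Collect_restrict)
  finally show ?thesis .
qed

lemma integrable_gaussian:
  fixes a :: real
  assumes "a > 0"
  shows "integrable lborel (\<lambda>u. exp (- (a * u\<^sup>2)))"
proof -
  \<comment> \<open>The centred normal density of variance 1 / (2 a) has exponent - a u^2; the
    prefactor removes its normalisation.\<close>
  have "integrable lborel (\<lambda>u. sqrt (2 * pi * (sqrt (1 / (2*a)))\<^sup>2) * normal_density 0 (sqrt (1 / (2*a))) u)"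
    using assms by (intro integrable_mult_right integrable_normal_density) auto
  also have "(\<lambda>u. sqrt (2 * pi * (sqrt (1 / (2*a)))\<^sup>2) * normal_density 0 (sqrt (1 / (2*a))) u) = (\<lambda>u. exp (- (a * u\<^sup>2)))"
    using assms by (auto simp: normal_density_def fun_eq_iff)
  finally show ?thesis .
qed

lemma integral_standard_gaussian:
  "(\<integral>u. complex_of_real (exp (- (u\<^sup>2 / 2))) \<partial>lborel) = of_real (sqrt (2 * pi))"
proof -
  have "(\<integral>u. exp (- (u\<^sup>2 / 2)) \<partial>lborel) = (\<integral>u. sqrt (2 * pi) * std_normal_density u \<partial>lborel)"
    by (simp add: std_normal_density_def)
  also have "\<dots> = sqrt (2 * pi)"
    by simp
  finally show ?thesis by (simp only: integral_complex_of_real)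
qed

lemma local_limit_from_char:
  fixes f :: "nat \<Rightarrow> real \<Rightarrow> complex" and p b :: "nat \<Rightarrow> real" and a :: real
  assumes b: "filterlim b at_top sequentially" and a: "a > 0"
    and p: "\<forall>\<^sub>F N in sequentially. (CLINT t:{-pi..pi}|lborel. f N t) = of_real (2 * pi * p N)"
    and meas: "\<forall>\<^sub>F N in sequentially. f N \<in> borel_measurable borel"
    and decay: "\<forall>\<^sub>F N in sequentially. \<forall>t\<in>{-pi..pi}. norm (f N t) \<le> exp (- (a * (b N)\<^sup>2 * t\<^sup>2))"
    and lim: "\<And>u. (\<lambda>N. f N (u / b N)) \<longlonglongrightarrow> of_real (exp (- (u\<^sup>2 / 2)))"
  shows "(\<lambda>N. b N * p N) \<longlonglongrightarrow> 1 / sqrt (2 * pi)"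
proof -
  have bpos: "\<forall>\<^sub>F N in sequentially. b N > 0"
    using b by (simp add: filterlim_at_top_dense)
  obtain N0 where N0: "\<And>N. N \<ge> N0 \<Longrightarrow> b N > 0"
    "\<And>N. N \<ge> N0 \<Longrightarrow> (CLINT t:{-pi..pi}|lborel. f N t) = of_real (2 * pi * p N)"
    "\<And>N. N \<ge> N0 \<Longrightarrow> f N \<in> borel_measurable borel"
    "\<And>N t. N \<ge> N0 \<Longrightarrow> t \<in> {-pi..pi} \<Longrightarrow> norm (f N t) \<le> exp (- (a * (b N)\<^sup>2 * t\<^sup>2))"
    using eventually_conj[OF bpos eventually_conj[OF p eventually_conj[OF meas decay]]]
    unfolding eventually_sequentially by blast
  define s where "s N u = indicator {-pi..pi} (u / b N) *\<^sub>R f N (u / b N)" for N u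
  have int: "(\<integral>u. s N u \<partial>lborel) = of_real (2 * pi * (b N * p N))" if "N \<ge> N0" for N
  proof -
    have "of_real (2 * pi * p N) = (\<integral>t. indicator {-pi..pi} t *\<^sub>R f N t \<partial>lborel)"
      using N0(2)[OF that] by (simp add: set_lebesgue_integral_def)
    also have "\<dots> = \<bar>1 / b N\<bar> *\<^sub>R (\<integral>u. indicator {-pi..pi} (0 + 1 / b N * u) *\<^sub>R f N (0 + 1 / b N * u) \<partial>lborel)"
      using N0(1)[OF that] by (intro lborel_integral_real_affine) auto
    also have "\<dots> = (1 / b N) *\<^sub>R (\<integral>u. s N u \<partial>lborel)"
      using N0(1)[OF that] by (simp add: s_def)
    finally show ?thesis
      using N0(1)[OF that] by (simp add: scaleR_conv_of_real field_simps)
  qed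
  \<comment> \<open>Dominated convergence asks for its hypotheses at every index, whereas they hold
    from \<open>N0\<close> on; hence the shift.\<close>
  have "(\<lambda>N. \<integral>u. s (N + N0) u \<partial>lborel) \<longlonglongrightarrow> (\<integral>u. complex_of_real (exp (- (u\<^sup>2 / 2))) \<partial>lborel)"
  proof (rule integral_dominated_convergence[where w = "\<lambda>u. exp (- (a * u\<^sup>2))"])
    show "s (N + N0) \<in> borel_measurable lborel" for N
      using N0(3)[of "N + N0"] unfolding s_def by measurable
    show "AE u in lborel. norm (s (N + N0) u) \<le> exp (- (a * u\<^sup>2))" for N
    proof (rule AE_I2)
      fix u
      show "norm (s (N + N0) u) \<le> exp (- (a * u\<^sup>2))"
        using N0(4)[of "N + N0" "u / b (N + N0)"] N0(1)[of "N + N0"]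
        by (auto simp: s_def indicator_def power_divide)
    qed
    show "AE u in lborel. (\<lambda>N. s (N + N0) u) \<longlonglongrightarrow> complex_of_real (exp (- (u\<^sup>2 / 2)))"
    proof (rule AE_I2)
      fix u :: real
      \<comment> \<open>For fixed u the cut-off in \<open>s\<close> is eventually inactive, because
        u / b N enters the open window.\<close>
      have "(\<lambda>N. u / b N) \<longlonglongrightarrow> 0"
        using b by (rule real_tendsto_divide_at_top[OF tendsto_const])
      then have "\<forall>\<^sub>F N in sequentially. u / b N \<in> {-pi<..<pi}"
        by (rule topological_tendstoD) auto
      then have "\<forall>\<^sub>F N in sequentially. f N (u / b N) = s N u"
        by eventually_elim (auto simp: s_def)
      with lim[of u] have "(\<lambda>N. s N u) \<longlonglongrightarrow> complex_of_real (exp (- (u\<^sup>2 / 2)))"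
        by (rule Lim_transform_eventually)
      then show "(\<lambda>N. s (N + N0) u) \<longlonglongrightarrow> complex_of_real (exp (- (u\<^sup>2 / 2)))"
        by (rule LIMSEQ_ignore_initial_segment)
    qed
  qed (auto intro: integrable_gaussian[OF a])
  then have "(\<lambda>N. complex_of_real (2 * pi * (b (N + N0) * p (N + N0)))) \<longlonglongrightarrow> of_real (sqrt (2 * pi))"
    unfolding integral_standard_gaussian by (simp add: int)
  then have "(\<lambda>N. 2 * pi * (b (N + N0) * p (N + N0))) \<longlonglongrightarrow> sqrt (2 * pi)"
    by (simp only: tendsto_of_real_iff)
  then have "(\<lambda>N. 2 * pi * (b N * p N)) \<longlonglongrightarrow> sqrt (2 * pi)"
    by (rule LIMSEQ_offset)
  from tendsto_divide[OF this tendsto_const[of "2 * pi"]]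
  have "(\<lambda>N. b N * p N) \<longlonglongrightarrow> sqrt (2 * pi) / (2 * pi)" by simp
  also have "sqrt (2 * pi) / (2 * pi) = 1 / sqrt (2 * pi)"
    by (simp add: sqrt_divide_self_eq inverse_eq_divide)
  finally show ?thesis .
qed

section \<open>Characteristic function bounds\<close>

text \<open>Half-angle formula and Jordan's inequality sin x \<ge> 2 x / pi on [0, pi / 2]. The
  constant is sharp at t = pi, so the bound is usable up to the ends of the inversion
  window.\<close>

lemma one_minus_cos_ge:
  fixes t :: real
  assumes "\<bar>t\<bar> \<le> pi"
  shows "1 - cos t \<ge> 2 * t\<^sup>2 / pi\<^sup>2"
proof -
  have "concave_on {0..pi} sin"
    by (rule f''_le0_imp_concave[where f' = cos and f'' = "\<lambda>x. - sin x"])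
       (auto intro!: derivative_eq_intros sin_ge_zero)
  \<comment> \<open>The point \<bar>t\<bar> / 2 is the convex combination of 0 and pi / 2 with
    weight \<bar>t\<bar> / pi on pi / 2, where sine equals 1.\<close>
  from concave_onD[OF this, of "\<bar>t\<bar> / pi" 0 "pi / 2"]
  have sin_ge: "sin (\<bar>t\<bar> / 2) \<ge> \<bar>t\<bar> / pi"
    using assms by simp
  have "(\<bar>t\<bar> / pi)\<^sup>2 \<le> (sin (\<bar>t\<bar> / 2))\<^sup>2"
    by (rule power_mono[OF sin_ge]) simp
  moreover have "cos t = 1 - 2 * (sin (\<bar>t\<bar> / 2))\<^sup>2"
    using cos_double_sin[of "\<bar>t\<bar> / 2"] by simp
  ultimately show ?thesis by (simp add: power_divide)
qed

lemma exp_minus_quadratic: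
  fixes x :: real
  assumes "x \<ge> 0"
  shows "\<bar>exp (- x) - (1 - x)\<bar> \<le> x\<^sup>2 / 2"
proof -
  have "1 - x \<le> exp (- x)" using exp_ge_add_one_self[of "- x"] by simp
  have "1 = exp (- x) * exp x" by (simp add: exp_minus)
  moreover have "exp x \<ge> 1 + x + x\<^sup>2 / 2" by (rule exp_lower_Taylor_quadratic[OF assms])
  ultimately have "exp (- x) * (1 + x + x\<^sup>2 / 2) \<le> 1"
    by (metis mult_left_mono exp_ge_zero)
  \<comment> \<open>The two quadratic Taylor polynomials multiply to 1 + x^4 / 4, so the bound for
    exp x inverts to one for exp (- x) after cancelling the positive factor 1 + x + x^2 / 2.\<close>
  also have "1 \<le> (1 - x + x\<^sup>2 / 2) * (1 + x + x\<^sup>2 / 2)"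
  proof -
    have "(1 - x + x\<^sup>2 / 2) * (1 + x + x\<^sup>2 / 2) = 1 + (x\<^sup>2 / 2)\<^sup>2"
      by (simp add: power2_eq_square algebra_simps)
    then show ?thesis by simp
  qed
  finally have "exp (- x) \<le> 1 - x + x\<^sup>2 / 2"
    using assms by (metis add_pos_nonneg mult_le_cancel_right_pos zero_less_one divide_nonneg_nonneg zero_le_power2 zero_le_numeral)
  with \<open>1 - x \<le> exp (- x)\<close> show ?thesis by simp
qed

text \<open>On the closed left half-plane, which is convex, the derivative of exp has modulus at
  most 1. The lemma is used for Poisson exponents and, on the imaginary axis, for changing the
  target and the set of nodes.\<close>

lemma norm_exp_diff_le:
  fixes x y :: complex
  assumes "Re x \<le> 0" "Re y \<le> 0"
  shows "norm (exp x - exp y) \<le> norm (x - y)"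
proof -
  have "norm (exp x - exp y) \<le> 1 * norm (x - y)"
  proof (rule field_differentiable_bound[where S = "{z. Re z \<le> 0}" and f' = exp])
    show "convex {z. Re z \<le> 0}" by (rule convex_halfspace_Re_le)
  qed (use assms in \<open>auto intro!: derivative_eq_intros\<close>)
  then show ?thesis by simp
qed

section \<open>Moments of discrete laws and sums of independent variables\<close>

text \<open>The image law has density k \<mapsto> P(X = k) against counting measure. The general
  codomain covers both real moments and complex characteristic functions.\<close>

lemma (in prob_space) expectation_nat:
  fixes X :: "'a \<Rightarrow> nat" and f :: "nat \<Rightarrow> 'b::{banach, second_countable_topology}"
  assumes [measurable]: "X \<in> M \<rightarrow>\<^sub>M count_space UNIV"
    and sum: "summable (\<lambda>k. prob {\<omega> \<in> space M. X \<omega> = k} * norm (f k))"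
  shows "integrable M (\<lambda>\<omega>. f (X \<omega>))"
    and "(\<lambda>k. prob {\<omega> \<in> space M. X \<omega> = k} *\<^sub>R f k) sums expectation (\<lambda>\<omega>. f (X \<omega>))"
proof -
  let ?p = "\<lambda>k. prob {\<omega> \<in> space M. X \<omega> = k}"
  have D: "distr M (count_space UNIV) X = density (count_space UNIV) (\<lambda>k. ennreal (?p k))"
  proof (rule measure_eqI_countable[where A = UNIV])
    fix k :: nat
    have "X -` {k} \<inter> space M = {\<omega> \<in> space M. X \<omega> = k}" by auto
    then show "emeasure (distr M (count_space UNIV) X) {k} =
        emeasure (density (count_space UNIV) (\<lambda>k. ennreal (?p k))) {k}"
      by (simp add: emeasure_distr emeasure_density emeasure_eq_measure nn_integral_count_space_indicator
          nn_integral_count_space_finite one_ennreal_def[symmetric] flip: nn_integral_count_space_indicator)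
  qed auto
  have int: "integrable (count_space UNIV) (\<lambda>k. ?p k *\<^sub>R f k)"
    using sum by (simp add: integrable_count_space_nat_iff)
  then have "integrable (distr M (count_space UNIV) X) f"
    by (simp add: D integrable_density)
  then show "integrable M (\<lambda>\<omega>. f (X \<omega>))"
    by (subst (asm) integrable_distr_eq) auto
  have "expectation (\<lambda>\<omega>. f (X \<omega>)) = integral\<^sup>L (distr M (count_space UNIV) X) f"
    by (subst integral_distr) auto
  also have "\<dots> = (\<integral>k. ?p k *\<^sub>R f k \<partial>count_space UNIV)"
    by (simp add: D integral_density)
  finally show "(\<lambda>k. ?p k *\<^sub>R f k) sums expectation (\<lambda>\<omega>. f (X \<omega>))"
    using sums_integral_count_space_nat[OF int] by simp
qed

lemma (in prob_space) variance_sum_indep: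
  fixes X :: "'i \<Rightarrow> 'a \<Rightarrow> real"
  assumes "finite A" and "indep_vars (\<lambda>_. borel) X A"
    and "\<And>i. i \<in> A \<Longrightarrow> integrable M (X i)" and "\<And>i. i \<in> A \<Longrightarrow> integrable M (\<lambda>\<omega>. (X i \<omega>)\<^sup>2)"
  shows "integrable M (\<lambda>\<omega>. (\<Sum>i\<in>A. X i \<omega>)\<^sup>2)"
    and "variance (\<lambda>\<omega>. \<Sum>i\<in>A. X i \<omega>) = (\<Sum>i\<in>A. variance (X i))"
proof -
  have "integrable M (\<lambda>\<omega>. (\<Sum>i\<in>A. X i \<omega>)\<^sup>2) \<and>
      variance (\<lambda>\<omega>. \<Sum>i\<in>A. X i \<omega>) = (\<Sum>i\<in>A. variance (X i))"
    using assms
  proof (induction A rule: finite_induct)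
    case (insert i A)
    let ?S = "\<lambda>\<omega>. \<Sum>i\<in>A. X i \<omega>"
    have IH: "integrable M (\<lambda>\<omega>. (?S \<omega>)\<^sup>2)" "variance ?S = (\<Sum>i\<in>A. variance (X i))"
      using insert.IH insert.prems indep_vars_subset[OF insert.prems(1), of A] by auto
    \<comment> \<open>Independence of the new variable from the partial sum factorises the cross
      term, which the subtraction of squared means then cancels.\<close>
    have ind: "indep_var borel (X i) borel ?S"
      by (rule indep_vars_sum[OF insert.hyps insert.prems(1)])
    have intX: "integrable M (X i)" "integrable M (\<lambda>\<omega>. (X i \<omega>)\<^sup>2)" and intS: "integrable M ?S"
      using insert.prems by auto
    have prod: "integrable M (\<lambda>\<omega>. X i \<omega> * ?S \<omega>)"
      "expectation (\<lambda>\<omega>. X i \<omega> * ?S \<omega>) = expectation (X i) * expectation ?S"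
      using indep_var_integrable[OF ind intX(1) intS] indep_var_lebesgue_integral[OF ind intX(1) intS]
      by auto
    have sq: "(\<Sum>j\<in>insert i A. X j \<omega>)\<^sup>2 = (X i \<omega>)\<^sup>2 + 2 * (X i \<omega> * ?S \<omega>) + (?S \<omega>)\<^sup>2" for \<omega>
      using insert.hyps by (simp add: power2_sum algebra_simps)
    have int: "integrable M (\<lambda>\<omega>. (\<Sum>j\<in>insert i A. X j \<omega>)\<^sup>2)"
      unfolding sq by (intro Bochner_Integration.integrable_add integrable_mult_right intX prod(1) IH(1))
    have "expectation (\<lambda>\<omega>. (\<Sum>j\<in>insert i A. X j \<omega>)\<^sup>2) = expectation (\<lambda>\<omega>. (X i \<omega>)\<^sup>2) +
        2 * (expectation (X i) * expectation ?S) + expectation (\<lambda>\<omega>. (?S \<omega>)\<^sup>2)"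
      unfolding sq using intX prod IH(1) by simp
    moreover have "expectation (\<lambda>\<omega>. \<Sum>j\<in>insert i A. X j \<omega>) = expectation (X i) + expectation ?S"
      using insert.hyps intX(1) intS by simp
    moreover have "integrable M (\<lambda>\<omega>. \<Sum>j\<in>insert i A. X j \<omega>)"
      using insert.prems by auto
    ultimately have "variance (\<lambda>\<omega>. \<Sum>j\<in>insert i A. X j \<omega>) = variance (X i) + variance ?S"
      unfolding variance_eq[OF intX] variance_eq[OF intS IH(1)]
      by (subst variance_eq) (simp_all add: int power2_sum algebra_simps)
    with int IH(2) insert.hyps show ?case by simp
  qed simp
  then show "integrable M (\<lambda>\<omega>. (\<Sum>i\<in>A. X i \<omega>)\<^sup>2)"
    and "variance (\<lambda>\<omega>. \<Sum>i\<in>A. X i \<omega>) = (\<Sum>i\<in>A. variance (X i))" by auto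
qed

text \<open>The form of the bounds in \<open>near_gaussian\<close>, linear in the variance with constants independent of
  the law, makes them stable under sums of independent variables.\<close>

definition near_gaussian :: "'a measure \<Rightarrow> real \<Rightarrow> real \<Rightarrow> ('a \<Rightarrow> real) \<Rightarrow> bool" where
  "near_gaussian M a B X \<longleftrightarrow>
     integrable M X \<and> integrable M (\<lambda>\<omega>. (X \<omega>)\<^sup>2) \<and>
     (\<forall>t. \<bar>t\<bar> \<le> pi \<longrightarrow>
        norm (CLINT \<omega>|M. iexp (t * (X \<omega> - integral\<^sup>L M X)))
          \<le> exp (- (a * prob_space.variance M X * t\<^sup>2)) \<and>
        norm ((CLINT \<omega>|M. iexp (t * (X \<omega> - integral\<^sup>L M X))) - complex_of_real (exp (- (prob_space.variance M X * t\<^sup>2 / 2))))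
          \<le> B * prob_space.variance M X * \<bar>t\<bar> ^ 3)"

lemma (in prob_space) near_gaussian_mono:
  assumes "near_gaussian M a B X" "a' \<le> a" "B \<le> B'"
  shows "near_gaussian M a' B' X"
proof -
  have "exp (- (a * variance X * t\<^sup>2)) \<le> exp (- (a' * variance X * t\<^sup>2))"
    "B * variance X * \<bar>t\<bar> ^ 3 \<le> B' * variance X * \<bar>t\<bar> ^ 3" for t
    using assms(2,3) by (auto intro!: mult_right_mono variance_positive)
  with assms(1) show ?thesis
    unfolding near_gaussian_def by (meson order_trans)
qed

text \<open>The centred characteristic function of the sum is a product. Moduli multiply, which adds
  the variances in the exponent; errors add by telescoping, since all factors compared lie in the
  closed unit disc.\<close>

lemma (in prob_space) near_gaussian_sum:
  fixes X :: "'i \<Rightarrow> 'a \<Rightarrow> real"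
  assumes A: "finite A" and ind: "indep_vars (\<lambda>_. borel) X A"
    and X: "\<And>i. i \<in> A \<Longrightarrow> near_gaussian M a B (X i)"
  shows "near_gaussian M a B (\<lambda>\<omega>. \<Sum>i\<in>A. X i \<omega>)"
proof -
  have int: "integrable M (X i)" "integrable M (\<lambda>\<omega>. (X i \<omega>)\<^sup>2)" if "i \<in> A" for i
    using X[OF that] by (auto simp: near_gaussian_def)
  have var: "integrable M (\<lambda>\<omega>. (\<Sum>i\<in>A. X i \<omega>)\<^sup>2)"
    "variance (\<lambda>\<omega>. \<Sum>i\<in>A. X i \<omega>) = (\<Sum>i\<in>A. variance (X i))"
    using variance_sum_indep[OF A ind int] by auto
  let ?\<phi> = "\<lambda>t i. CLINT \<omega>|M. iexp (t * (X i \<omega> - expectation (X i)))"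
  have prod: "(CLINT \<omega>|M. iexp (t * ((\<Sum>i\<in>A. X i \<omega>) - expectation (\<lambda>\<omega>. \<Sum>i\<in>A. X i \<omega>)))) =
      (\<Prod>i\<in>A. ?\<phi> t i)" for t
  proof -
    have ind': "indep_vars (\<lambda>_. borel) (\<lambda>i \<omega>. iexp (t * (X i \<omega> - expectation (X i)))) A"
      by (rule indep_vars_compose2[OF ind]) measurable
    have rv: "random_variable borel (X i)" if "i \<in> A" for i
      using int(1)[OF that] by simp
    have int': "integrable M (\<lambda>\<omega>. iexp (t * (X i \<omega> - expectation (X i))))" if "i \<in> A" for i
      using rv[OF that] by (intro integrable_iexp) auto
    have E: "expectation (\<lambda>\<omega>. \<Sum>i\<in>A. X i \<omega>) = (\<Sum>i\<in>A. expectation (X i))"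
      by (rule Bochner_Integration.integral_sum) (rule int(1))
    have "iexp (t * ((\<Sum>i\<in>A. X i \<omega>) - expectation (\<lambda>\<omega>. \<Sum>i\<in>A. X i \<omega>))) =
        (\<Prod>i\<in>A. iexp (t * (X i \<omega> - expectation (X i))))" for \<omega>
      unfolding E using A by (simp add: exp_sum[symmetric] sum_distrib_left sum_subtractf[symmetric])
    with indep_vars_lebesgue_integral[OF A ind' int'] show ?thesis by simp
  qed
  have norm1: "norm (?\<phi> t i) \<le> 1" if "i \<in> A" for t i
  proof -
    have "norm (?\<phi> t i) \<le> (\<integral>\<omega>. norm (iexp (t * (X i \<omega> - expectation (X i)))) \<partial>M)"
      by (rule integral_norm_bound)
    then show ?thesis by (simp add: prob_space)
  qed
  show ?thesis unfolding near_gaussian_def prod var(2)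
  proof (intro conjI allI impI)
    show "integrable M (\<lambda>\<omega>. \<Sum>i\<in>A. X i \<omega>)" using int by auto
    show "integrable M (\<lambda>\<omega>. (\<Sum>i\<in>A. X i \<omega>)\<^sup>2)" by (rule var(1))
    fix t :: real assume t: "\<bar>t\<bar> \<le> pi"
    have "norm (\<Prod>i\<in>A. ?\<phi> t i) = (\<Prod>i\<in>A. norm (?\<phi> t i))" by (rule prod_norm[symmetric])
    also have "\<dots> \<le> (\<Prod>i\<in>A. exp (- (a * variance (X i) * t\<^sup>2)))"
      using X t by (intro prod_mono) (auto simp: near_gaussian_def)
    also have "\<dots> = exp (- (a * (\<Sum>i\<in>A. variance (X i)) * t\<^sup>2))"
      using A by (simp add: exp_sum[symmetric] sum_negf sum_distrib_left sum_distrib_right)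
    finally show "norm (\<Prod>i\<in>A. ?\<phi> t i) \<le> exp (- (a * (\<Sum>i\<in>A. variance (X i)) * t\<^sup>2))" .
    have E: "complex_of_real (exp (- ((\<Sum>i\<in>A. variance (X i)) * t\<^sup>2 / 2))) =
        (\<Prod>i\<in>A. complex_of_real (exp (- (variance (X i) * t\<^sup>2 / 2))))"
      using A by (simp add: exp_sum[symmetric] sum_negf sum_distrib_right sum_divide_distrib flip: of_real_prod)
    have "norm ((\<Prod>i\<in>A. ?\<phi> t i) - complex_of_real (exp (- ((\<Sum>i\<in>A. variance (X i)) * t\<^sup>2 / 2)))) \<le>
        (\<Sum>i\<in>A. norm (?\<phi> t i - complex_of_real (exp (- (variance (X i) * t\<^sup>2 / 2)))))"
      \<comment> \<open>Both families of factors have modulus at most 1: \<open>norm1\<close> for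
        the characteristic functions, nonnegativity of variances for the Gaussian ones.\<close>
      unfolding E by (intro norm_prod_diff norm1) (auto intro: variance_positive)
    also have "\<dots> \<le> (\<Sum>i\<in>A. B * variance (X i) * \<bar>t\<bar> ^ 3)"
      using X t by (intro sum_mono) (auto simp: near_gaussian_def)
    also have "\<dots> = B * (\<Sum>i\<in>A. variance (X i)) * \<bar>t\<bar> ^ 3"
      by (simp add: sum_distrib_left sum_distrib_right)
    finally show "norm ((\<Prod>i\<in>A. ?\<phi> t i) - complex_of_real (exp (- ((\<Sum>i\<in>A. variance (X i)) * t\<^sup>2 / 2))))
        \<le> B * (\<Sum>i\<in>A. variance (X i)) * \<bar>t\<bar> ^ 3" .
  qed
qed

section \<open>Truncated geometric laws\<close>

text \<open>The law of a single-server free variable is prescribed up to its capacity. Since these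
  masses already sum to 1, larger values are null, and every function of the variable has a finite
  expectation given by a finite sum.\<close>

lemma (in prob_space) expectation_finite_nat:
  fixes X :: "'a \<Rightarrow> nat" and f :: "nat \<Rightarrow> 'b::{banach, second_countable_topology}"
  assumes [measurable]: "X \<in> M \<rightarrow>\<^sub>M count_space UNIV"
    and total: "(\<Sum>k\<le>c. prob {\<omega> \<in> space M. X \<omega> = k}) = 1"
  shows "integrable M (\<lambda>\<omega>. f (X \<omega>))"
    and "expectation (\<lambda>\<omega>. f (X \<omega>)) = (\<Sum>k\<le>c. prob {\<omega> \<in> space M. X \<omega> = k} *\<^sub>R f k)"
    and "AE \<omega> in M. X \<omega> \<le> c"
proof -
  let ?p = "\<lambda>k. prob {\<omega> \<in> space M. X \<omega> = k}"
  have "prob (\<Union>k\<in>{..c}. {\<omega> \<in> space M. X \<omega> = k}) = (\<Sum>k\<le>c. ?p k)"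
    by (rule finite_measure_finite_Union) (auto simp: disjoint_family_on_def)
  also have "(\<Union>k\<in>{..c}. {\<omega> \<in> space M. X \<omega> = k}) = {\<omega> \<in> space M. X \<omega> \<le> c}" by auto
  finally have "prob {\<omega> \<in> space M. X \<omega> \<le> c} = 1" using total by simp
  then show AE: "AE \<omega> in M. X \<omega> \<le> c"
    by (subst (asm) prob_Collect_eq_1) auto
  have zero: "?p k = 0" if "k > c" for k
  proof -
    from AE have "AE \<omega> in M. X \<omega> \<noteq> k" by eventually_elim (use that in auto)
    then show ?thesis by (subst prob_Collect_eq_0) auto
  qed
  have summable: "summable (\<lambda>k. ?p k * norm (f k))"
    by (rule summable_finite[of "{..c}"]) (auto simp: zero)
  note E = expectation_nat[OF assms(1) this]
  show "integrable M (\<lambda>\<omega>. f (X \<omega>))" by (rule E(1))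
  have "(\<lambda>k. ?p k *\<^sub>R f k) sums (\<Sum>k\<le>c. ?p k *\<^sub>R f k)"
    by (rule sums_finite) (auto simp: zero)
  with E(2) show "expectation (\<lambda>\<omega>. f (X \<omega>)) = (\<Sum>k\<le>c. ?p k *\<^sub>R f k)"
    by (rule sums_unique2)
qed

text \<open>The squared modulus is the characteristic function of the difference of two independent
  copies. Its defect from 1 is a double sum of nonnegative terms p k p l (1 - cos (t (k - l))), of
  which only the pairs with k = l + 1 are kept.\<close>

lemma norm_finite_char_le:
  fixes p :: "nat \<Rightarrow> real"
  assumes nonneg: "\<And>k. p k \<ge> 0" and total: "(\<Sum>k\<le>c. p k) = 1"
  shows "(norm (\<Sum>k\<le>c. p k *\<^sub>R iexp (t * real k)))\<^sup>2 \<le> 1 - (1 - cos t) * (\<Sum>k<c. p k * p (Suc k))"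
proof -
  have "(norm (\<Sum>k\<le>c. p k *\<^sub>R iexp (t * real k)))\<^sup>2 =
      (\<Sum>k\<le>c. p k * cos (t * real k))\<^sup>2 + (\<Sum>k\<le>c. p k * sin (t * real k))\<^sup>2"
    by (simp add: cmod_power2 Re_exp Im_exp)
  also have "\<dots> = (\<Sum>k\<le>c. \<Sum>l\<le>c. p k * p l * cos (t * (real k - real l)))"
    by (simp add: power2_eq_square sum_product sum.distrib[symmetric] right_diff_distrib cos_diff algebra_simps)
  finally have *: "(norm (\<Sum>k\<le>c. p k *\<^sub>R iexp (t * real k)))\<^sup>2 =
    (\<Sum>k\<le>c. \<Sum>l\<le>c. p k * p l * cos (t * (real k - real l)))" .
  have "1 = (\<Sum>k\<le>c. \<Sum>l\<le>c. p k * p l)"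
    using total by (simp add: sum_product[symmetric])
  with * have "1 - (norm (\<Sum>k\<le>c. p k *\<^sub>R iexp (t * real k)))\<^sup>2 =
      (\<Sum>k\<le>c. \<Sum>l\<le>c. p k * p l * (1 - cos (t * (real k - real l))))"
    by (simp add: sum_subtractf right_diff_distrib)
  also have "\<dots> = (\<Sum>(k,l)\<in>{..c} \<times> {..c}. p k * p l * (1 - cos (t * (real k - real l))))"
    by (simp add: sum.cartesian_product)
  also have "\<dots> \<ge> (\<Sum>(k,l)\<in>(\<lambda>k. (Suc k, k)) ` {..<c}. p k * p l * (1 - cos (t * (real k - real l))))"
    by (rule sum_mono2) (auto intro!: mult_nonneg_nonneg nonneg)
  also have "(\<Sum>(k,l)\<in>(\<lambda>k. (Suc k, k)) ` {..<c}. p k * p l * (1 - cos (t * (real k - real l)))) =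
      (1 - cos t) * (\<Sum>k<c. p k * p (Suc k))"
    by (subst sum.reindex) (auto simp: inj_on_def sum_distrib_left algebra_simps)
  finally show ?thesis by simp
qed

text \<open>Geometric weights are monotone in the index, so each product \<open>p k * p l\<close> with \<open>k \<noteq> l\<close> is at
  most a product of adjacent weights.\<close>

lemma truncated_geometric_variance_le:
  fixes \<rho> Z :: real
  assumes \<rho>: "\<rho> \<ge> 0" and Z: "Z > 0" and p: "\<And>k. k \<le> c \<Longrightarrow> p k = \<rho> ^ k / Z"
    and nonneg: "\<And>k. p k \<ge> 0" and total: "(\<Sum>k\<le>c. p k) = 1"
  shows "(\<Sum>k\<le>c. p k * (real k)\<^sup>2) - (\<Sum>k\<le>c. p k * real k)\<^sup>2
    \<le> real (c + 1) ^ 4 * (\<Sum>k<c. p k * p (Suc k))"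
proof -
  let ?Q = "\<Sum>k<c. p k * p (Suc k)" and ?m = "\<Sum>k\<le>c. p k * real k" and ?s = "\<Sum>k\<le>c. p k * (real k)\<^sup>2"
  have Q0: "?Q \<ge> 0" by (intro sum_nonneg mult_nonneg_nonneg nonneg)
  have adj: "p k * p (Suc k) \<le> ?Q" if "k < c" for k
    using that by (intro member_le_sum) (auto intro: mult_nonneg_nonneg nonneg)
  have pair: "p k * p l \<le> ?Q" if "k < l" "l \<le> c" for k l
  \<comment> \<open>For decreasing weights the larger index l is lowered to k + 1; for increasing
    weights the smaller index k is raised to l - 1.\<close>
  proof (cases "\<rho> \<le> 1")
    case True
    have "p l \<le> p (Suc k)"
      using that True \<rho> Z by (auto simp: p simp del: power_Suc intro!: divide_right_mono power_decreasing)
    then have "p k * p l \<le> p k * p (Suc k)" by (intro mult_left_mono nonneg)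
    also have "\<dots> \<le> ?Q" using that by (intro adj) auto
    finally show ?thesis .
  next
    case False
    from that obtain l' where l': "l = Suc l'" by (cases l) auto
    have "p k \<le> p l'"
      using that False Z by (auto simp: p l' intro!: divide_right_mono power_increasing)
    then have "p k * p l \<le> p l' * p (Suc l')" unfolding l' by (intro mult_right_mono nonneg)
    also have "\<dots> \<le> ?Q" using that l' by (intro adj) auto
    finally show ?thesis .
  qed
  \<comment> \<open>Twice the variance is the second moment of the difference of two independent
    copies, the same difference whose characteristic function gives the decay.\<close>
  have "(\<Sum>k\<le>c. \<Sum>l\<le>c. p k * p l * (real k - real l)\<^sup>2) =
      (\<Sum>k\<le>c. \<Sum>l\<le>c. (p k * (real k)\<^sup>2) * p l + p k * (p l * (real l)\<^sup>2) - 2 * ((p k * real k) * (p l * real l)))"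
    by (simp add: power2_diff algebra_simps)
  also have "\<dots> = ?s * (\<Sum>l\<le>c. p l) + (\<Sum>k\<le>c. p k) * ?s - 2 * (?m * ?m)"
    by (simp only: sum.distrib sum_subtractf sum_product sum_distrib_left[symmetric])
  also have "\<dots> = 2 * (?s - ?m\<^sup>2)" using total by (simp add: power2_eq_square)
  finally have "2 * (?s - ?m\<^sup>2) = (\<Sum>k\<le>c. \<Sum>l\<le>c. p k * p l * (real k - real l)\<^sup>2)" by simp
  \<comment> \<open>There are (c + 1)^2 pairs, and each squared distance is at most (c + 1)^2: this
    is the fourth power. The factor 2 on the left is given away at the end.\<close>
  also have "\<dots> \<le> (\<Sum>k\<le>c. \<Sum>l\<le>c. real (c + 1) ^ 2 * ?Q)"
  proof (intro sum_mono)
    fix k l assume kl: "k \<in> {..c}" "l \<in> {..c}"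
    show "p k * p l * (real k - real l)\<^sup>2 \<le> real (c + 1) ^ 2 * ?Q"
    proof (cases "k = l")
      case False
      then have "p k * p l \<le> ?Q"
        using pair[of k l] pair[of l k] kl by (cases "k < l") (auto simp: mult.commute)
      moreover have "(real k - real l)\<^sup>2 \<le> real (c + 1) ^ 2"
        using kl by (intro abs_le_square_iff[THEN iffD1]) auto
      ultimately have "p k * p l * (real k - real l)\<^sup>2 \<le> ?Q * real (c + 1) ^ 2"
        by (intro mult_mono Q0) auto
      then show ?thesis by (simp add: mult.commute)
    qed (use Q0 in simp)
  qed
  also have "\<dots> = real (c + 1) ^ 4 * ?Q" by (simp add: power4_eq_xxxx power2_eq_square)
  finally have "2 * (?s - ?m\<^sup>2) \<le> real (c + 1) ^ 4 * ?Q" .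
  moreover have "real (c + 1) ^ 4 * ?Q \<ge> 0" using Q0 by simp
  moreover have "x \<le> y" if "2 * x \<le> y" "y \<ge> 0" for x y :: real using that by linarith
  ultimately show ?thesis by blast
qed

text \<open>With Q the adjacent-weight sum, the variance v satisfies v \<le> (C + 1)^4 Q, so 1 minus
  the squared modulus is at least 2 a v t^2 for the stated rate a. In the cubic constant, C / 6 is
  the Taylor remainder of the characteristic function and C^2 pi / 8 that of the Gaussian.\<close>

lemma (in prob_space) near_gaussian_truncated_geometric:
  fixes X :: "'a \<Rightarrow> nat"
  assumes [measurable]: "X \<in> M \<rightarrow>\<^sub>M count_space UNIV" and \<rho>: "\<rho> \<ge> 0" and "c \<le> C"
    and law: "\<And>k. k \<le> c \<Longrightarrow> prob {\<omega> \<in> space M. X \<omega> = k} = \<rho> ^ k / (\<Sum>h\<le>c. \<rho> ^ h)"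
  shows "near_gaussian M (1 / (pi\<^sup>2 * real (C + 1) ^ 4)) (real C / 6 + (real C)\<^sup>2 * pi / 8) (\<lambda>\<omega>. real (X \<omega>))"
    and "variance (\<lambda>\<omega>. real (X \<omega>)) \<le> (real C)\<^sup>2"
    and "expectation (\<lambda>\<omega>. real (X \<omega>)) = (\<Sum>k\<le>c. real k * \<rho> ^ k) / (\<Sum>h\<le>c. \<rho> ^ h)"
    and "AE \<omega> in M. X \<omega> \<le> c"
proof -
  define p where "p k = prob {\<omega> \<in> space M. X \<omega> = k}" for k
  define Z where "Z = (\<Sum>h\<le>c. \<rho> ^ h)"
  define \<mu> where "\<mu> = expectation (\<lambda>\<omega>. real (X \<omega>))"
  define v where "v = variance (\<lambda>\<omega>. real (X \<omega>))"
  let ?Y = "\<lambda>\<omega>. real (X \<omega>) - \<mu>"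
  \<comment> \<open>The zeroth term is 1 even for \<rho> = 0, so the degenerate law at 0 is
    covered.\<close>
  have "\<rho> ^ 0 \<le> Z" unfolding Z_def by (rule member_le_sum) (use \<rho> in auto)
  then have Z: "Z > 0" by simp
  have p: "p k = \<rho> ^ k / Z" if "k \<le> c" for k using law[OF that] by (simp add: p_def Z_def)
  have p0: "p k \<ge> 0" for k by (simp add: p_def)
  have total: "(\<Sum>k\<le>c. p k) = 1"
    using Z by (simp add: p sum_divide_distrib[symmetric] Z_def)
  note fin = expectation_finite_nat[OF assms(1), of c, folded p_def, OF total]
  show AE: "AE \<omega> in M. X \<omega> \<le> c" by (rule fin(3))
  have \<mu>: "\<mu> = (\<Sum>k\<le>c. p k * real k)" unfolding \<mu>_def by (simp add: fin(2))
  then show "expectation (\<lambda>\<omega>. real (X \<omega>)) = (\<Sum>k\<le>c. real k * \<rho> ^ k) / (\<Sum>h\<le>c. \<rho> ^ h)"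
    unfolding \<mu>_def by (simp add: p Z_def sum_divide_distrib mult.commute)
  have \<mu>0: "\<mu> \<ge> 0" unfolding \<mu>_def by simp
  have \<mu>c: "\<mu> \<le> real c"
  proof -
    have "\<mu> \<le> (\<Sum>k\<le>c. p k * real c)" unfolding \<mu> by (intro sum_mono mult_left_mono p0) auto
    then show ?thesis using total by (simp add: sum_distrib_right[symmetric])
  qed
  have AEC: "AE \<omega> in M. \<bar>?Y \<omega>\<bar> \<le> real C"
    using AE by eventually_elim (use \<mu>0 \<mu>c \<open>c \<le> C\<close> in auto)
  have int: "integrable M (\<lambda>\<omega>. real (X \<omega>))" "integrable M (\<lambda>\<omega>. (real (X \<omega>))\<^sup>2)"
    "integrable M ?Y" "integrable M (\<lambda>\<omega>. (?Y \<omega>)\<^sup>2)"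
    by (rule fin(1))+
  have v0: "v \<ge> 0" unfolding v_def by (rule variance_positive)
  have v: "v = expectation (\<lambda>\<omega>. (?Y \<omega>)\<^sup>2)" by (simp add: v_def \<mu>_def)
  have "v \<le> expectation (\<lambda>\<omega>. (real C)\<^sup>2)" unfolding v
  proof (rule integral_mono_AE[OF int(4)])
    show "AE \<omega> in M. (?Y \<omega>)\<^sup>2 \<le> (real C)\<^sup>2"
      using AEC by eventually_elim (rule abs_le_square_iff[THEN iffD1], simp)
  qed simp
  then have vC: "v \<le> (real C)\<^sup>2" by (simp add: prob_space)
  then show "variance (\<lambda>\<omega>. real (X \<omega>)) \<le> (real C)\<^sup>2" by (simp add: v_def)
  let ?Q = "\<Sum>k<c. p k * p (Suc k)"
  have Q0: "?Q \<ge> 0" by (intro sum_nonneg mult_nonneg_nonneg p0)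
  have "v = expectation (\<lambda>\<omega>. (real (X \<omega>))\<^sup>2) - \<mu>\<^sup>2"
    using variance_eq[OF int(1,2)] by (simp add: v_def \<mu>_def)
  also have "\<dots> = (\<Sum>k\<le>c. p k * (real k)\<^sup>2) - (\<Sum>k\<le>c. p k * real k)\<^sup>2"
    unfolding \<mu> using fin(2)[of "\<lambda>k. (real k)\<^sup>2"] by simp
  also have "\<dots> \<le> real (c + 1) ^ 4 * ?Q"
    by (rule truncated_geometric_variance_le[OF \<rho> Z p p0 total])
  also have "\<dots> \<le> real (C + 1) ^ 4 * ?Q"
    using \<open>c \<le> C\<close> Q0 by (intro mult_right_mono power_mono) auto
  finally have vQ: "v / real (C + 1) ^ 4 \<le> ?Q"
    by (simp add: field_simps)
  show "near_gaussian M (1 / (pi\<^sup>2 * real (C + 1) ^ 4)) (real C / 6 + (real C)\<^sup>2 * pi / 8) (\<lambda>\<omega>. real (X \<omega>))"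
    unfolding near_gaussian_def \<mu>_def[symmetric] v_def[unfolded \<mu>_def[symmetric], symmetric]
  proof (intro conjI allI impI int)
    fix t :: real assume t: "\<bar>t\<bar> \<le> pi"
    let ?\<phi> = "CLINT \<omega>|M. iexp (t * ?Y \<omega>)"
    have "?\<phi> = (CLINT \<omega>|M. iexp (- (t * \<mu>)) * iexp (t * real (X \<omega>)))"
      by (simp add: exp_add[symmetric] algebra_simps)
    also have "\<dots> = iexp (- (t * \<mu>)) * (CLINT \<omega>|M. iexp (t * real (X \<omega>)))"
      by (rule integral_mult_right_zero)
    also have "\<dots> = iexp (- (t * \<mu>)) * (\<Sum>k\<le>c. p k *\<^sub>R iexp (t * real k))"
      by (subst fin(2)[of "\<lambda>k. iexp (t * real k)"]) simp
    finally have "(norm ?\<phi>)\<^sup>2 = (norm (\<Sum>k\<le>c. p k *\<^sub>R iexp (t * real k)))\<^sup>2"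
      by (simp only: norm_mult norm_exp_i_times mult_1)
    also have "\<dots> \<le> 1 - (1 - cos t) * ?Q" by (rule norm_finite_char_le[OF p0 total])
    also have "\<dots> \<le> 1 - (2 * t\<^sup>2 / pi\<^sup>2) * (v / real (C + 1) ^ 4)"
      using mult_mono[OF one_minus_cos_ge[OF t] vQ] v0 Q0 by simp
    also have "\<dots> \<le> 1 + - (2 * (1 / (pi\<^sup>2 * real (C + 1) ^ 4) * v * t\<^sup>2))"
      by (simp add: mult_ac)
    also have "\<dots> \<le> exp (- (2 * (1 / (pi\<^sup>2 * real (C + 1) ^ 4) * v * t\<^sup>2)))"
      by (rule exp_ge_add_one_self)
    also have "\<dots> = (exp (- (1 / (pi\<^sup>2 * real (C + 1) ^ 4) * v * t\<^sup>2)))\<^sup>2"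
      by (simp add: exp_double[symmetric])
    finally show "norm ?\<phi> \<le> exp (- (1 / (pi\<^sup>2 * real (C + 1) ^ 4) * v * t\<^sup>2))"
      by (rule power2_le_imp_le) simp
    \<comment> \<open>Taking the cubic branch of the minimum and bounding one factor \<bar>Y\<bar>
      by C leaves a second moment; this keeps the remainder proportional to v.\<close>
    have "expectation (\<lambda>\<omega>. min (6 * (?Y \<omega>)\<^sup>2) (\<bar>t\<bar> * \<bar>?Y \<omega>\<bar> ^ 3)) \<le> expectation (\<lambda>\<omega>. \<bar>t\<bar> * real C * (?Y \<omega>)\<^sup>2)"
    proof (rule integral_mono_AE)
      show "integrable M (\<lambda>\<omega>. min (6 * (?Y \<omega>)\<^sup>2) (\<bar>t\<bar> * \<bar>?Y \<omega>\<bar> ^ 3))" by (rule fin(1))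
      show "AE \<omega> in M. min (6 * (?Y \<omega>)\<^sup>2) (\<bar>t\<bar> * \<bar>?Y \<omega>\<bar> ^ 3) \<le> \<bar>t\<bar> * real C * (?Y \<omega>)\<^sup>2"
        using AEC
      proof eventually_elim
        case (elim \<omega>)
        have "\<bar>?Y \<omega>\<bar> ^ 3 = \<bar>?Y \<omega>\<bar> * (?Y \<omega>)\<^sup>2" by (simp add: power3_eq_cube power2_eq_square)
        also have "\<dots> \<le> real C * (?Y \<omega>)\<^sup>2" using elim by (intro mult_right_mono) auto
        finally have "\<bar>t\<bar> * \<bar>?Y \<omega>\<bar> ^ 3 \<le> \<bar>t\<bar> * (real C * (?Y \<omega>)\<^sup>2)" by (intro mult_left_mono) auto
        then show ?case by (simp add: mult.assoc min.coboundedI2)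
      qed
    qed (use int(4) in auto)
    also have "\<dots> = \<bar>t\<bar> * real C * v" by (simp add: v)
    finally have moment: "expectation (\<lambda>\<omega>. min (6 * (?Y \<omega>)\<^sup>2) (\<bar>t\<bar> * \<bar>?Y \<omega>\<bar> ^ 3)) \<le> \<bar>t\<bar> * real C * v" .
    have "norm (?\<phi> - (1 - t\<^sup>2 * v / 2)) \<le> (t\<^sup>2 / 6) * expectation (\<lambda>\<omega>. min (6 * (?Y \<omega>)\<^sup>2) (\<bar>t\<bar> * \<bar>?Y \<omega>\<bar> ^ 3))"
    proof -
      have 0: "expectation ?Y = 0" using int(1) by (simp add: \<mu>_def prob_space)
      have "variance ?Y = v" unfolding 0 using v by simp
      from char_approx3'[OF _ int(3,4) 0 this refl, of t] show ?thesis
        by (simp add: char_def integral_distr)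
    qed
    also have "\<dots> \<le> (t\<^sup>2 / 6) * (\<bar>t\<bar> * real C * v)"
      by (rule mult_left_mono[OF moment]) simp
    also have "\<dots> = real C / 6 * v * \<bar>t\<bar> ^ 3"
      by (simp add: power3_eq_cube power2_eq_square)
    finally have 1: "norm (?\<phi> - (1 - t\<^sup>2 * v / 2)) \<le> real C / 6 * v * \<bar>t\<bar> ^ 3" .
    have "\<bar>exp (- (v * t\<^sup>2 / 2)) - (1 - v * t\<^sup>2 / 2)\<bar> \<le> (v * t\<^sup>2 / 2)\<^sup>2 / 2"
      by (rule exp_minus_quadratic) (use v0 in auto)
    also have "(v * t\<^sup>2 / 2)\<^sup>2 / 2 = (v / 8) * (v * \<bar>t\<bar>) * \<bar>t\<bar> ^ 3"
      by (simp add: power2_eq_square power3_eq_cube)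
    \<comment> \<open>Of v^2 t^4, one factor v is bounded by C^2 and one factor \<bar>t\<bar> by pi,
      so that v \<bar>t\<bar>^3 remains.\<close>
    also have "\<dots> \<le> (v / 8) * ((real C)\<^sup>2 * pi) * \<bar>t\<bar> ^ 3"
      using v0 vC t by (intro mult_right_mono mult_left_mono mult_mono) auto
    finally have 2: "norm (complex_of_real (1 - v * t\<^sup>2 / 2) - complex_of_real (exp (- (v * t\<^sup>2 / 2))))
        \<le> (real C)\<^sup>2 * pi / 8 * v * \<bar>t\<bar> ^ 3"
      by (subst of_real_diff[symmetric], subst norm_of_real) (simp add: abs_minus_commute mult_ac)
    have "norm (?\<phi> - complex_of_real (exp (- (v * t\<^sup>2 / 2)))) \<le>
        norm (?\<phi> - (1 - t\<^sup>2 * v / 2)) + norm (complex_of_real (1 - v * t\<^sup>2 / 2) - complex_of_real (exp (- (v * t\<^sup>2 / 2))))"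
      by (rule order_trans[OF _ norm_triangle_ineq]) (simp add: mult.commute)
    with 1 2 show "norm (?\<phi> - complex_of_real (exp (- (v * t\<^sup>2 / 2)))) \<le>
        (real C / 6 + (real C)\<^sup>2 * pi / 8) * v * \<bar>t\<bar> ^ 3"
      by (simp add: distrib_right)
  qed
qed

section \<open>Poisson laws\<close>

text \<open>The centred characteristic function is exp (r (e^(it) - 1 - it)). Its modulus is exp (-
  r (1 - cos t)), and its exponent differs from - r t^2 / 2 by at most r \<bar>t\<bar>^3 / 6. As r
  is the variance, both constants are absolute although the support is unbounded.\<close>

lemma (in prob_space) near_gaussian_poisson:
  fixes X :: "'a \<Rightarrow> nat"
  assumes meas: "X \<in> M \<rightarrow>\<^sub>M count_space UNIV" and l: "r \<ge> 0"
    and law: "\<And>k. prob {\<omega> \<in> space M. X \<omega> = k} = r ^ k / fact k * exp (- r)"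
  shows "near_gaussian M (2 / pi\<^sup>2) (1 / 6) (\<lambda>\<omega>. real (X \<omega>))"
    and "expectation (\<lambda>\<omega>. real (X \<omega>)) = r"
    and "variance (\<lambda>\<omega>. real (X \<omega>)) = r"
proof -
  have s0: "(\<lambda>k. r ^ k / fact k * exp (- r)) sums 1"
    using sums_mult2[OF exp_converges[of r], of "exp (- r)"] by (simp add: exp_minus field_simps)
  have fact_ratio: "real (Suc k) / fact (Suc k) = 1 / fact k" for k
    by (subst fact_Suc) (simp del: of_nat_Suc)
  have s1: "(\<lambda>k. r ^ k / fact k * exp (- r) * real k) sums r"
  proof -
    have "r ^ Suc k / fact (Suc k) * exp (- r) * real (Suc k) = r * (r ^ k / fact k * exp (- r))" for k
    proof -
      have "r ^ Suc k / fact (Suc k) * exp (- r) * real (Suc k) = r ^ Suc k * exp (- r) * (real (Suc k) / fact (Suc k))"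
        by (simp only: times_divide_eq_left times_divide_eq_right mult_ac)
      then show ?thesis by (simp only: fact_ratio) simp
    qed
    then have "(\<lambda>k. r ^ Suc k / fact (Suc k) * exp (- r) * real (Suc k)) sums r"
      using sums_mult[OF s0, of r] by (simp only: mult_1_right)
    from sums_Suc[OF this] show ?thesis by simp
  qed
  \<comment> \<open>After cancelling one factor k against k! and shifting the index, the remaining
    factor k + 1 splits this series into r times the first-moment series plus r times the total
    mass.\<close>
  have s2: "(\<lambda>k. r ^ k / fact k * exp (- r) * (real k)\<^sup>2) sums (r\<^sup>2 + r)"
  proof -
    have "r ^ Suc k / fact (Suc k) * exp (- r) * (real (Suc k))\<^sup>2 =
        r * (r ^ k / fact k * exp (- r) * real k) + r * (r ^ k / fact k * exp (- r))" for k
    proof -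
      have "r ^ Suc k / fact (Suc k) * exp (- r) * (real (Suc k))\<^sup>2 =
          r ^ Suc k * exp (- r) * (real (Suc k) / fact (Suc k)) * real (Suc k)"
        by (simp only: times_divide_eq_left times_divide_eq_right mult_ac power2_eq_square)
      then show ?thesis by (simp only: fact_ratio) (simp add: field_simps)
    qed
    then have "(\<lambda>k. r ^ Suc k / fact (Suc k) * exp (- r) * (real (Suc k))\<^sup>2) sums (r\<^sup>2 + r)"
      using sums_add[OF sums_mult[OF s1, of r] sums_mult[OF s0, of r]]
      by (simp only: mult_1_right power2_eq_square[of r])
    from sums_Suc[OF this] show ?thesis by simp
  qed
  note E1 = expectation_nat[OF meas, unfolded law, of real]
  note E2 = expectation_nat[OF meas, unfolded law, of "\<lambda>k. (real k)\<^sup>2"]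
  have int1: "integrable M (\<lambda>\<omega>. real (X \<omega>))"
    by (rule E1(1)) (use s1 in \<open>auto dest: sums_summable\<close>)
  have int2: "integrable M (\<lambda>\<omega>. (real (X \<omega>))\<^sup>2)"
    by (rule E2(1)) (use s2 in \<open>auto dest: sums_summable\<close>)
  have "(\<lambda>k. (r ^ k / fact k * exp (- r)) *\<^sub>R real k) sums expectation (\<lambda>\<omega>. real (X \<omega>))"
    by (rule E1(2)) (use s1 in \<open>auto dest: sums_summable\<close>)
  then show e1: "expectation (\<lambda>\<omega>. real (X \<omega>)) = r"
    using s1 by (auto intro: sums_unique2)
  have "(\<lambda>k. (r ^ k / fact k * exp (- r)) *\<^sub>R (real k)\<^sup>2) sums expectation (\<lambda>\<omega>. (real (X \<omega>))\<^sup>2)"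
    by (rule E2(2)) (use s2 in \<open>auto dest: sums_summable\<close>)
  then have "expectation (\<lambda>\<omega>. (real (X \<omega>))\<^sup>2) = r\<^sup>2 + r"
    using s2 by (auto intro: sums_unique2)
  then show v: "variance (\<lambda>\<omega>. real (X \<omega>)) = r"
    using variance_eq[OF int1 int2] by (simp add: e1)
  have char: "(CLINT \<omega>|M. iexp (t * (real (X \<omega>) - r))) = exp (of_real r * (iexp t - 1 - \<i> * of_real t))" for t
  proof -
    let ?z = "of_real r * iexp t"
    \<comment> \<open>Moving the centring phase and exp (- r) into one constant leaves the
      exponential series at r e^(it).\<close>
    have eq: "(r ^ k / fact k * exp (- r)) *\<^sub>R iexp (t * (real k - r)) =
        (?z ^ k /\<^sub>R fact k) * exp (- of_real r - \<i> * of_real t * of_real r)" for k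
    proof -
      have "iexp (t * (real k - r)) = iexp t ^ k * exp (- (\<i> * of_real t * of_real r))"
        by (simp add: exp_of_nat_mult[symmetric] exp_add[symmetric] algebra_simps)
      moreover have "complex_of_real (exp (- r)) * exp (- (\<i> * of_real t * of_real r)) = exp (- of_real r - \<i> * of_real t * of_real r)"
        by (simp add: exp_of_real[symmetric] exp_add[symmetric])
      ultimately show ?thesis
        by (simp add: scaleR_conv_of_real power_mult_distrib field_simps)
    qed
    have "(\<lambda>k. (?z ^ k /\<^sub>R fact k) * exp (- of_real r - \<i> * of_real t * of_real r)) sums
        (exp ?z * exp (- of_real r - \<i> * of_real t * of_real r))"
      by (rule sums_mult2[OF exp_converges])
    also have "exp ?z * exp (- of_real r - \<i> * of_real t * of_real r) = exp (of_real r * (iexp t - 1 - \<i> * of_real t))"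
      by (simp add: exp_add[symmetric] algebra_simps)
    finally have "(\<lambda>k. (r ^ k / fact k * exp (- r)) *\<^sub>R iexp (t * (real k - r))) sums exp (of_real r * (iexp t - 1 - \<i> * of_real t))"
      unfolding eq .
    moreover have "(\<lambda>k. (r ^ k / fact k * exp (- r)) *\<^sub>R iexp (t * (real k - r))) sums (CLINT \<omega>|M. iexp (t * (real (X \<omega>) - r)))"
      using expectation_nat(2)[OF meas, unfolded law, of "\<lambda>k. iexp (t * (real k - r))"] s0
      by (auto dest: sums_summable)
    ultimately show ?thesis by (rule sums_unique2[symmetric])
  qed
  show "near_gaussian M (2 / pi\<^sup>2) (1 / 6) (\<lambda>\<omega>. real (X \<omega>))"
    unfolding near_gaussian_def v unfolding e1 char
  proof (intro conjI allI impI int1 int2)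
    fix t :: real assume t: "\<bar>t\<bar> \<le> pi"
    have "r * (2 * t\<^sup>2 / pi\<^sup>2) \<le> r * (1 - cos t)" by (rule mult_left_mono[OF one_minus_cos_ge[OF t] l])
    then show "norm (exp (of_real r * (iexp t - 1 - \<i> * of_real t))) \<le> exp (- (2 / pi\<^sup>2 * r * t\<^sup>2))"
      by (simp add: Re_exp algebra_simps)
    have e: "norm (iexp t - 1 - \<i> * of_real t + of_real (t\<^sup>2 / 2)) \<le> \<bar>t\<bar> ^ 3 / 6"
      using iexp_approx1[of t 2] by (simp add: numeral_2_eq_2 numeral_3_eq_3 algebra_simps)
    \<comment> \<open>Both exponents have nonpositive real part, r (cos t - 1) and - r t^2 / 2, so
      distances of exponentials reduce to distances of exponents.\<close>
    have "norm (exp (of_real r * (iexp t - 1 - \<i> * of_real t)) - complex_of_real (exp (- (r * t\<^sup>2 / 2)))) \<le>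
        norm (of_real r * (iexp t - 1 - \<i> * of_real t) - complex_of_real (- (r * t\<^sup>2 / 2)))"
      unfolding exp_of_real[symmetric] using l
      by (intro norm_exp_diff_le) (simp_all add: Re_exp mult_nonneg_nonpos)
    also have "of_real r * (iexp t - 1 - \<i> * of_real t) - complex_of_real (- (r * t\<^sup>2 / 2)) =
        of_real r * (iexp t - 1 - \<i> * of_real t + of_real (t\<^sup>2 / 2))"
      by (simp add: algebra_simps)
    also have "norm \<dots> = r * norm (iexp t - 1 - \<i> * of_real t + of_real (t\<^sup>2 / 2))"
      using l by (simp only: norm_mult norm_of_real abs_of_nonneg)
    also have "\<dots> \<le> r * (\<bar>t\<bar> ^ 3 / 6)" by (rule mult_left_mono[OF e l])
    finally show "norm (exp (of_real r * (iexp t - 1 - \<i> * of_real t)) - complex_of_real (exp (- (r * t\<^sup>2 / 2)))) \<le> 1 / 6 * r * \<bar>t\<bar> ^ 3"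
      by simp
  qed
qed

section \<open>Positivity of utilizations and joint laws\<close>

text \<open>Mass spreads along edges: t l \<ge> t k * p k l > 0 whenever t k and p k l are positive.
  Total mass 1 provides a positive starting point, and irreducibility a path from it to j.\<close>

lemma irreducible_invariant_pos:
  assumes "finite V" "transition_matrix V p" "irreducible_matrix V p"
    "probability_vector V t" "invariant_vector V p t" "j \<in> V"
  shows "t j > 0"
proof -
  have t0: "t i \<ge> 0" if "i \<in> V" for i using assms(4) that by (simp add: probability_vector_def)
  obtain i where i: "i \<in> V" "t i > 0"
  proof -
    have "\<exists>i\<in>V. t i > 0"
    proof (rule ccontr)
      assume "\<not> (\<exists>i\<in>V. t i > 0)"
      then have "(\<Sum>i\<in>V. t i) \<le> 0" by (intro sum_nonpos) auto
      then show False using assms(4) by (simp add: probability_vector_def)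
    qed
    then show thesis using that by blast
  qed
  have "(i, j) \<in> {(k, l). k \<in> V \<and> l \<in> V \<and> p k l > 0}\<^sup>*"
    using assms(3,6) i by (auto simp: irreducible_matrix_def)
  then show ?thesis
  proof induction
    case (step k l)
    then have kl: "k \<in> V" "l \<in> V" "p k l > 0" by auto
    have "0 < t k * p k l" using step kl by simp
    also have "\<dots> \<le> (\<Sum>k\<in>V. t k * p k l)"
      using assms(1,2) kl t0 by (intro member_le_sum) (auto simp: transition_matrix_def)
    also have "\<dots> = t l" using assms(5) kl by (simp add: invariant_vector_def)
    finally show ?case .
  qed (rule i(2))
qed

lemma finite_nodes: "network_on N net \<Longrightarrow> finite (nodes net)"
  by (simp add: network_on_def)

lemma utilization_pos:
  assumes net: "network_on N net"
    and dyn: "blocking net w \<or> blocking_rerouting net w \<or> state_dependent_routing net w"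
    and j: "j \<in> nodes net"
  shows "utilization net j > 0"
proof -
  have "visit net j > 0"
    using dyn
  proof (elim disjE)
    assume "blocking net w"
    then show ?thesis
      unfolding blocking_def using irreducible_invariant_pos[OF finite_nodes[OF net] _ _ _ _ j] by blast
  next
    assume "blocking_rerouting net w"
    then show ?thesis
      unfolding blocking_rerouting_def using irreducible_invariant_pos[OF finite_nodes[OF net] _ _ _ _ j] by blast
  next
    assume "state_dependent_routing net w"
    then show ?thesis using j by (simp add: state_dependent_routing_def)
  qed
  then show ?thesis
    using net j by (simp add: utilization_def network_on_def)
qed

section \<open>Joint laws of integer-valued variables\<close>

lemma measurable_sum_nat:
  fixes X :: "'i \<Rightarrow> 'a \<Rightarrow> nat"
  assumes "\<And>i. i \<in> A \<Longrightarrow> X i \<in> M \<rightarrow>\<^sub>M count_space UNIV"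
  shows "(\<lambda>\<omega>. \<Sum>i\<in>A. X i \<omega>) \<in> M \<rightarrow>\<^sub>M count_space UNIV"
  using assms
proof (induction A rule: infinite_finite_induct)
  case (insert i A)
  have "(\<lambda>\<omega>. X i \<omega> + (\<Sum>i\<in>A. X i \<omega>)) \<in> M \<rightarrow>\<^sub>M count_space UNIV"
    by (rule measurable_compose_countable[where g = "X i" and f = "\<lambda>k \<omega>. k + (\<Sum>i\<in>A. X i \<omega>)"])
       (use insert in \<open>auto intro: measurable_compose[OF _ measurable_count_space]\<close>)
  then show ?case using insert by simp
qed auto

lemma (in prob_space) prob_joint_point:
  fixes X :: "'i \<Rightarrow> 'a \<Rightarrow> nat"
  assumes ind: "indep_vars (\<lambda>_. count_space UNIV) X I" and J: "finite J" "J \<subseteq> I"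
  shows "prob {\<omega> \<in> space M. \<forall>j\<in>J. X j \<omega> = n j} = (\<Prod>j\<in>J. prob {\<omega> \<in> space M. X j \<omega> = n j})"
proof (cases "J = {}")
  case False
  have "{\<omega> \<in> space M. \<forall>j\<in>J. X j \<omega> = n j} = (\<Inter>j\<in>J. X j -` {n j} \<inter> space M)"
    using False by auto
  then have "prob {\<omega> \<in> space M. \<forall>j\<in>J. X j \<omega> = n j} = (\<Prod>j\<in>J. prob (X j -` {n j} \<inter> space M))"
    using indep_varsD[OF ind False J, of "\<lambda>j. {n j}"] by simp
  also have "\<dots> = (\<Prod>j\<in>J. prob {\<omega> \<in> space M. X j \<omega> = n j})"
    by (intro prod.cong refl arg_cong[where f = prob]) auto
  finally show ?thesis .
qed (simp add: prob_space)

text \<open>The coordinates inside and outside \<open>J\<close> form two independent random vectors;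
  the event is a box for the first and a level set of the coordinate sum for the second.\<close>

lemma (in prob_space) prob_point_and_sum:
  fixes X :: "'i \<Rightarrow> 'a \<Rightarrow> nat" and k :: int
  assumes ind: "indep_vars (\<lambda>_. count_space UNIV) X I" and I: "finite I" "J \<subseteq> I"
  shows "prob {\<omega> \<in> space M. (\<forall>j\<in>J. X j \<omega> = n j) \<and> int (\<Sum>j\<in>I-J. X j \<omega>) = k} =
    prob {\<omega> \<in> space M. \<forall>j\<in>J. X j \<omega> = n j} * prob {\<omega> \<in> space M. int (\<Sum>j\<in>I-J. X j \<omega>) = k}"
proof -
  let ?P = "\<lambda>J. PiM J (\<lambda>_. count_space (UNIV :: nat set))"
  let ?A = "PiE J (\<lambda>j. {n j})"
  let ?B = "(\<lambda>f. \<Sum>j\<in>I-J. f j) -` {i. int i = k} \<inter> space (?P (I - J))"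
  have fin: "finite J" using I finite_subset by auto
  have ind2: "indep_var (?P J) (\<lambda>\<omega>. restrict (\<lambda>i. X i \<omega>) J) (?P (I-J)) (\<lambda>\<omega>. restrict (\<lambda>i. X i \<omega>) (I-J))"
    by (rule indep_var_restrict[OF ind]) (use I in auto)
  have A: "?A \<in> sets (?P J)" by (rule sets_PiM_I_finite[OF fin]) auto
  have "(\<lambda>f. \<Sum>j\<in>I-J. f j) \<in> ?P (I-J) \<rightarrow>\<^sub>M count_space UNIV"
    by (rule measurable_sum_nat) simp
  then have B: "?B \<in> sets (?P (I - J))" by (rule measurable_sets) auto
  have "(\<lambda>\<omega>. (restrict (\<lambda>i. X i \<omega>) J, restrict (\<lambda>i. X i \<omega>) (I-J))) -` (?A \<times> ?B) \<inter> space M =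
      {\<omega> \<in> space M. (\<forall>j\<in>J. X j \<omega> = n j) \<and> int (\<Sum>j\<in>I-J. X j \<omega>) = k}"
    by (auto simp: space_PiM PiE_iff extensional_def)
  moreover have "(\<lambda>\<omega>. restrict (\<lambda>i. X i \<omega>) J) -` ?A \<inter> space M = {\<omega> \<in> space M. \<forall>j\<in>J. X j \<omega> = n j}"
    by (auto simp: PiE_iff extensional_def)
  moreover have "(\<lambda>\<omega>. restrict (\<lambda>i. X i \<omega>) (I-J)) -` ?B \<inter> space M =
      {\<omega> \<in> space M. int (\<Sum>j\<in>I-J. X j \<omega>) = k}"
    by (auto simp: space_PiM)
  ultimately show ?thesis using indep_varD[OF ind2 A B] by simp
qed

lemma finite_states:
  assumes "finite (nodes net)"
  shows "finite (states net L)"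
proof (rule finite_subset)
  show "states net L \<subseteq> {f. f \<in> nodes net \<rightarrow> {..L} \<and> (\<forall>j. j \<notin> nodes net \<longrightarrow> f j = 0)}"
    using assms by (auto simp: states_def intro: member_le_sum)
  show "finite {f. f \<in> nodes net \<rightarrow> {..L} \<and> (\<forall>j. j \<notin> nodes net \<longrightarrow> f j = (0::nat))}"
    using finite_set_of_finite_funs[OF assms finite_atMost[of L], of 0]
    by (rule finite_subset[rotated]) auto
qed

text \<open>A configuration is extended by 0 off the nodes to match the encoding of states; the
  event is then a finite disjoint union of point events. It serves both the free and the stationary
  variables, and \<open>J = {}\<close> gives the mass of the whole state space.\<close>

lemma (in prob_space) prob_states:
  fixes X :: "nat \<Rightarrow> 'a \<Rightarrow> nat"
  assumes fin: "finite (nodes net)" and [measurable]: "\<And>j. j \<in> nodes net \<Longrightarrow> X j \<in> M \<rightarrow>\<^sub>M count_space UNIV"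
    and J: "J \<subseteq> nodes net"
  shows "{\<omega> \<in> space M. (\<forall>j\<in>J. X j \<omega> = n j) \<and> (\<lambda>j. if j \<in> nodes net then X j \<omega> else 0) \<in> states net L} \<in> events"
    and "prob {\<omega> \<in> space M. (\<forall>j\<in>J. X j \<omega> = n j) \<and> (\<lambda>j. if j \<in> nodes net then X j \<omega> else 0) \<in> states net L} =
    (\<Sum>f\<in>{f \<in> states net L. \<forall>j\<in>J. f j = n j}. prob {\<omega> \<in> space M. \<forall>j\<in>nodes net. X j \<omega> = f j})"
proof -
  let ?A = "{\<omega> \<in> space M. (\<forall>j\<in>J. X j \<omega> = n j) \<and> (\<lambda>j. if j \<in> nodes net then X j \<omega> else 0) \<in> states net L}"
  let ?T = "{f \<in> states net L. \<forall>j\<in>J. f j = n j}"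
  let ?E = "\<lambda>f. {\<omega> \<in> space M. \<forall>j\<in>nodes net. X j \<omega> = f j}"
  have out: "f j = 0" if "f \<in> states net L" "j \<notin> nodes net" for f j
    using that by (simp add: states_def)
  have vec: "(\<lambda>j. if j \<in> nodes net then X j \<omega> else 0) = f" if "f \<in> states net L" "\<forall>j\<in>nodes net. X j \<omega> = f j" for f \<omega>
    using that out by (auto simp: fun_eq_iff)
  have eq: "?A = (\<Union>f\<in>?T. ?E f)"
  proof (intro set_eqI iffI)
    fix \<omega> assume *: "\<omega> \<in> ?A"
    show "\<omega> \<in> (\<Union>f\<in>?T. ?E f)"
      by (rule UN_I[of "\<lambda>j. if j \<in> nodes net then X j \<omega> else 0"]) (use * J in auto)
  next
    fix \<omega> assume "\<omega> \<in> (\<Union>f\<in>?T. ?E f)"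
    then obtain f where f: "f \<in> ?T" "\<omega> \<in> ?E f" by blast
    then have "\<forall>j\<in>J. X j \<omega> = n j" using J by fastforce
    then show "\<omega> \<in> ?A"
      using vec[of f \<omega>] f by simp
  qed
  have finT: "finite ?T" using finite_states[OF fin] by simp
  have events: "?E f \<in> events" for f
    using fin by (auto intro!: sets.sets_Collect_finite_All simp: assms(2))
  show "?A \<in> events" unfolding eq using finT events by auto
  have "prob (\<Union>f\<in>?T. ?E f) = (\<Sum>f\<in>?T. prob (?E f))"
  proof (rule finite_measure_finite_Union)
    show "finite ?T" by (rule finT)
    show "?E ` ?T \<subseteq> events" using events by auto
    show "disjoint_family_on ?E ?T"
      unfolding disjoint_family_on_def
    proof (intro ballI impI)
      fix f g assume fg: "f \<in> ?T" "g \<in> ?T" "f \<noteq> g"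
      show "?E f \<inter> ?E g = {}"
      proof (rule ccontr)
        assume "?E f \<inter> ?E g \<noteq> {}"
        then obtain \<omega> where "\<omega> \<in> ?E f" "\<omega> \<in> ?E g" by blast
        then have "f = g" using vec[of f \<omega>] vec[of g \<omega>] fg by auto
        with fg show False by simp
      qed
    qed
  qed
  then show "prob ?A = (\<Sum>f\<in>?T. prob (?E f))" unfolding eq .
qed

section \<open>A single closed network\<close>

text \<open>The dynamics are represented here by positivity of the utilizations, which all three
  routing schemes imply by \<open>utilization_pos\<close>. The stationary vector enters later, since
  it lives on another probability space.\<close>

locale closed_network =
  fixes net :: jackson_network and N :: nat and \<gamma> :: real and \<Omega> :: "'b measure"
    and \<eta> :: "nat \<Rightarrow> 'b \<Rightarrow> nat" and C :: nat
  assumes network: "network_on N net"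
    and utilization: "\<And>j. j \<in> nodes net \<Longrightarrow> utilization net j > 0"
    and potential: "chemical_potential net \<gamma>"
    and free: "free_variables net \<gamma> \<Omega> \<eta>"
    and capacity_le: "\<And>j. j \<in> single_server net \<Longrightarrow> the_enat (capacity net j) \<le> C"
begin

sublocale prob_space \<Omega>
  using free by (simp add: free_variables_def)

lemma nodes: "nodes net = {1..N}" "single_server net \<union> infinite_server net = {1..N}"
  "single_server net \<inter> infinite_server net = {}" "finite (single_server net)" "finite (infinite_server net)"
proof -
  show n: "nodes net = {1..N}" and "single_server net \<inter> infinite_server net = {}"
    using network by (auto simp: network_on_def)
  show u: "single_server net \<union> infinite_server net = {1..N}"
    using n by (simp add: nodes_def)
  have "finite (single_server net \<union> infinite_server net)" by (simp add: u)
  then show "finite (single_server net)" "finite (infinite_server net)" by auto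
qed

lemma node_cases: "j \<in> {1..N} \<Longrightarrow> j \<in> single_server net \<or> j \<in> infinite_server net"
  and infinite_node: "j \<in> infinite_server net \<Longrightarrow> j \<in> {1..N}"
  using nodes(2) by blast+

lemma capacity_single: "j \<in> single_server net \<Longrightarrow> capacity net j = enat (the_enat (capacity net j))"
  using network by (auto simp: network_on_def)

lemma gamma_nonneg: "\<gamma> \<ge> 0"
  using potential by (simp add: chemical_potential_def)

lemma load_nonneg: "j \<in> {1..N} \<Longrightarrow> \<gamma> * utilization net j \<ge> 0"
  using utilization[of j] gamma_nonneg by (simp add: nodes(1))

lemma indep: "indep_vars (\<lambda>_. count_space UNIV) \<eta> {1..N}"
  using free by (simp add: free_variables_def nodes(1))

lemma indep_real: "indep_vars (\<lambda>_. borel) (\<lambda>j \<omega>. real (\<eta> j \<omega>)) {1..N}"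
  by (rule indep_vars_compose2[OF indep]) auto

lemma measurable_eta: "j \<in> {1..N} \<Longrightarrow> \<eta> j \<in> \<Omega> \<rightarrow>\<^sub>M count_space UNIV"
  using indep by (auto simp: indep_vars_def)

lemma law_single:
  assumes "j \<in> single_server net" "k \<le> the_enat (capacity net j)"
  shows "prob {\<omega> \<in> space \<Omega>. \<eta> j \<omega> = k} =
    (\<gamma> * utilization net j) ^ k / (\<Sum>h\<le>the_enat (capacity net j). (\<gamma> * utilization net j) ^ h)"
  using free assms capacity_single[OF assms(1)]
  by (auto simp: free_variables_def atMost_atLeast0 enat_ord_simps(1)[symmetric] simp del: enat_ord_simps(1))

lemma law_infinite:
  assumes "j \<in> infinite_server net"
  shows "prob {\<omega> \<in> space \<Omega>. \<eta> j \<omega> = k} =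
    (\<gamma> * utilization net j) ^ k / fact k * exp (- (\<gamma> * utilization net j))"
  using free assms by (simp add: free_variables_def)

section \<open>Moments and Gaussian bounds at the nodes\<close>

abbreviation mean :: "nat \<Rightarrow> real" where "mean j \<equiv> expectation (\<lambda>\<omega>. real (\<eta> j \<omega>))"
abbreviation var :: "nat \<Rightarrow> real" where "var j \<equiv> variance (\<lambda>\<omega>. real (\<eta> j \<omega>))"

lemma single:
  assumes j: "j \<in> single_server net"
  shows "near_gaussian \<Omega> (1 / (pi\<^sup>2 * real (C + 1) ^ 4)) (real C / 6 + (real C)\<^sup>2 * pi / 8) (\<lambda>\<omega>. real (\<eta> j \<omega>))"
    and "var j \<le> (real C)\<^sup>2"
    and "mean j = (\<Sum>k\<le>the_enat (capacity net j). real k * (\<gamma> * utilization net j) ^ k) /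
      (\<Sum>h\<le>the_enat (capacity net j). (\<gamma> * utilization net j) ^ h)"
    and "AE \<omega> in \<Omega>. \<eta> j \<omega> \<le> the_enat (capacity net j)"
    and "mean j \<le> real C"
proof -
  have j': "j \<in> {1..N}" using j nodes by auto
  note * = near_gaussian_truncated_geometric[OF measurable_eta[OF j'] load_nonneg[OF j'] capacity_le[OF j] law_single[OF j]]
  show ng: "near_gaussian \<Omega> (1 / (pi\<^sup>2 * real (C + 1) ^ 4)) (real C / 6 + (real C)\<^sup>2 * pi / 8) (\<lambda>\<omega>. real (\<eta> j \<omega>))"
    and "var j \<le> (real C)\<^sup>2"
    and "mean j = (\<Sum>k\<le>the_enat (capacity net j). real k * (\<gamma> * utilization net j) ^ k) /
      (\<Sum>h\<le>the_enat (capacity net j). (\<gamma> * utilization net j) ^ h)"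
    and AE: "AE \<omega> in \<Omega>. \<eta> j \<omega> \<le> the_enat (capacity net j)"
    by (rule *; assumption)+
  have "mean j \<le> expectation (\<lambda>\<omega>. real C)"
  proof (rule integral_mono_AE)
    show "AE \<omega> in \<Omega>. real (\<eta> j \<omega>) \<le> real C"
      using AE by eventually_elim (use capacity_le[OF j] in auto)
  qed (use ng in \<open>auto simp: near_gaussian_def\<close>)
  then show "mean j \<le> real C" by (simp add: prob_space)
qed

lemma infinite:
  assumes j: "j \<in> infinite_server net"
  shows "near_gaussian \<Omega> (2 / pi\<^sup>2) (1 / 6) (\<lambda>\<omega>. real (\<eta> j \<omega>))"
    and "mean j = \<gamma> * utilization net j" and "var j = \<gamma> * utilization net j"
proof -
  have j': "j \<in> {1..N}" using j nodes by auto
  show "near_gaussian \<Omega> (2 / pi\<^sup>2) (1 / 6) (\<lambda>\<omega>. real (\<eta> j \<omega>))"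
    and "mean j = \<gamma> * utilization net j" and "var j = \<gamma> * utilization net j"
    by (rule near_gaussian_poisson[OF measurable_eta[OF j'] load_nonneg[OF j'] law_infinite[OF j]])+
qed

text \<open>Common constants for both kinds of node: \<open>decay\<close> is the smaller of the two
  rates, \<open>cubic\<close> the sum of the two cubic constants.\<close>

abbreviation decay :: real where "decay \<equiv> 1 / (pi\<^sup>2 * real (C + 1) ^ 4)"
abbreviation cubic :: real where "cubic \<equiv> 1 / 6 + real C / 6 + (real C)\<^sup>2 * pi / 8"

lemma near_gaussian_node:
  assumes "j \<in> {1..N}"
  shows "near_gaussian \<Omega> decay cubic (\<lambda>\<omega>. real (\<eta> j \<omega>))"
proof -
  consider "j \<in> single_server net" | "j \<in> infinite_server net" using node_cases[OF assms] by blast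
  then show ?thesis
  proof cases
    case 1
    show ?thesis by (rule near_gaussian_mono[OF single(1)[OF 1]]) auto
  next
    case 2
    have "real (C + 1) ^ 4 \<ge> 1" by (rule one_le_power) simp
    then have "pi\<^sup>2 * 1 \<le> pi\<^sup>2 * real (C + 1) ^ 4" by (intro mult_left_mono) auto
    then have "decay \<le> 1 / pi\<^sup>2" by (intro divide_left_mono) auto
    also have "\<dots> \<le> 2 / pi\<^sup>2" by (intro divide_right_mono) auto
    finally show ?thesis by (rule near_gaussian_mono[OF infinite(1)[OF 2]]) auto
  qed
qed

lemma near_gaussian_nodes:
  assumes "A \<subseteq> {1..N}"
  shows "near_gaussian \<Omega> decay cubic (\<lambda>\<omega>. \<Sum>j\<in>A. real (\<eta> j \<omega>))"
  by (rule near_gaussian_sum) (use assms near_gaussian_node finite_subset[OF assms] indep_vars_subset[OF indep_real assms] in auto)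

lemma integrable_node: "j \<in> {1..N} \<Longrightarrow> integrable \<Omega> (\<lambda>\<omega>. real (\<eta> j \<omega>))"
  "j \<in> {1..N} \<Longrightarrow> integrable \<Omega> (\<lambda>\<omega>. (real (\<eta> j \<omega>))\<^sup>2)"
  using near_gaussian_node[of j] by (auto simp: near_gaussian_def)

lemma expectation_nodes:
  "A \<subseteq> {1..N} \<Longrightarrow> expectation (\<lambda>\<omega>. \<Sum>j\<in>A. real (\<eta> j \<omega>)) = (\<Sum>j\<in>A. mean j)"
  by (intro Bochner_Integration.integral_sum integrable_node) auto

lemma variance_nodes:
  assumes "A \<subseteq> {1..N}"
  shows "variance (\<lambda>\<omega>. \<Sum>j\<in>A. real (\<eta> j \<omega>)) = (\<Sum>j\<in>A. var j)"
  by (rule variance_sum_indep(2))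
    (use assms finite_subset[OF assms] indep_vars_subset[OF indep_real assms] integrable_node in auto)

text \<open>The summands in the equation for \<open>\<gamma>\<close> are exactly the means of the
  free variables, so the target M is the mean of their sum.\<close>

lemma sum_mean: "(\<Sum>j\<in>{1..N}. mean j) = real (customers net)"
proof -
  have "(\<Sum>j\<in>{1..N}. mean j) = (\<Sum>j\<in>single_server net. mean j) + (\<Sum>j\<in>infinite_server net. mean j)"
    unfolding nodes(2)[symmetric] by (rule sum.union_disjoint) (use nodes in auto)
  also have "\<dots> = real (customers net)"
    using potential by (simp add: chemical_potential_def single(3) infinite(2) atMost_atLeast0)
  finally show ?thesis .
qed

definition load :: "nat set \<Rightarrow> real" where
  "load J = (\<Sum>j\<in>infinite_server net \<inter> J. \<gamma> * utilization net j)"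

lemma load_ge_0: "load J \<ge> 0"
  unfolding load_def by (rule sum_nonneg) (use load_nonneg infinite_node in blast)

text \<open>For a Poisson node mean and variance coincide with the load, so one bound serves both:
  with c = C for means and c = C^2 for variances.\<close>

lemma sum_le_load:
  assumes J: "J \<subseteq> {1..N}" and single: "\<And>j. j \<in> single_server net \<Longrightarrow> x j \<le> c"
    and infinite: "\<And>j. j \<in> infinite_server net \<Longrightarrow> x j = \<gamma> * utilization net j" and c: "c \<ge> 0"
  shows "(\<Sum>j\<in>J. x j) \<le> real (card J) * c + load J"
proof -
  have fin: "finite J" using J finite_subset by auto
  have "J = (single_server net \<inter> J) \<union> (infinite_server net \<inter> J)" using J nodes(2) by auto
  then have "(\<Sum>j\<in>J. x j) = (\<Sum>j\<in>(single_server net \<inter> J) \<union> (infinite_server net \<inter> J). x j)" by simp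
  also have "\<dots> = (\<Sum>j\<in>single_server net \<inter> J. x j) + (\<Sum>j\<in>infinite_server net \<inter> J. x j)"
    by (rule sum.union_disjoint) (use fin nodes(3) in auto)
  also have "(\<Sum>j\<in>infinite_server net \<inter> J. x j) = load J"
    unfolding load_def by (intro sum.cong refl infinite) auto
  also have "(\<Sum>j\<in>single_server net \<inter> J. x j) \<le> (\<Sum>j\<in>single_server net \<inter> J. c)"
    by (intro sum_mono single) auto
  also have "\<dots> \<le> real (card J) * c"
    using card_mono[OF fin, of "single_server net \<inter> J"] c by (simp add: mult_right_mono)
  finally show ?thesis by simp
qed

text \<open>At \<gamma> = 0 all free variables are almost surely 0. Positivity of \<gamma> makes
  every admissible point have positive probability, as the denominators of the ratio
  require.\<close>

lemma gamma_pos: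
  assumes "(\<Sum>j\<in>{1..N}. var j) > 0"
  shows "\<gamma> > 0"
proof (rule ccontr)
  assume "\<not> \<gamma> > 0"
  then have \<gamma>: "\<gamma> = 0" using gamma_nonneg by simp
  have "var j \<le> 0" if j: "j \<in> single_server net" for j
  proof -
    have j': "j \<in> {1..N}" using j nodes(2) by auto
    \<comment> \<open>The weights 0 ^ k reduce to a point mass at 0, so the geometric lemma applies
      with capacity and bound both 0 and gives variance at most 0.\<close>
    have law: "prob {\<omega> \<in> space \<Omega>. \<eta> j \<omega> = k} = 0 ^ k / (\<Sum>h\<le>0::nat. 0 ^ h)" if "k \<le> 0" for k
    proof -
      have "(\<Sum>h\<le>the_enat (capacity net j). (0::real) ^ h) = 1"
        by (simp add: power_0_left)
      then show ?thesis using law_single[OF j, of k] that \<gamma> by simp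
    qed
    from near_gaussian_truncated_geometric(2)[OF measurable_eta[OF j'] order_refl order_refl law]
    show ?thesis by simp
  qed
  moreover have "var j = 0" if "j \<in> infinite_server net" for j
    using infinite(3)[OF that] \<gamma> by simp
  ultimately have "(\<Sum>j\<in>{1..N}. var j) \<le> 0"
    unfolding nodes(2)[symmetric] by (intro sum_nonpos) (metis Un_iff order_refl)
  with assms show False by simp
qed

section \<open>Characteristic functions of totals\<close>

abbreviation total :: "nat set \<Rightarrow> 'b \<Rightarrow> nat" where "total A \<omega> \<equiv> \<Sum>j\<in>A. \<eta> j \<omega>"

text \<open>The phase of the inversion formula is absorbed into the exponent, so the integral over
  the window is directly 2 pi times a point probability.\<close>

definition shifted_char :: "nat set \<Rightarrow> int \<Rightarrow> real \<Rightarrow> complex" where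
  "shifted_char A k t = (CLINT \<omega>|\<Omega>. iexp (t * (real (total A \<omega>) - real_of_int k)))"

lemma measurable_total: "A \<subseteq> {1..N} \<Longrightarrow> total A \<in> \<Omega> \<rightarrow>\<^sub>M count_space UNIV"
  by (rule measurable_sum_nat) (use measurable_eta in auto)

lemma integral_shifted_char:
  assumes "A \<subseteq> {1..N}"
  shows "(CLINT t:{-pi..pi}|lborel. shifted_char A k t) = of_real (2 * pi * prob {\<omega> \<in> space \<Omega>. int (total A \<omega>) = k})"
  unfolding shifted_char_def by (rule Fourier_inversion_nat[OF measurable_total[OF assms]])

lemma measurable_shifted_char:
  assumes "A \<subseteq> {1..N}"
  shows "shifted_char A k \<in> borel_measurable borel"
proof -
  note [measurable] = measurable_total[OF assms]
  show ?thesis unfolding shifted_char_def by measurable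
qed

lemma norm_shifted_char_le:
  assumes A: "A \<subseteq> {1..N}" and t: "\<bar>t\<bar> \<le> pi"
  shows "norm (shifted_char A k t) \<le> exp (- (decay * (\<Sum>j\<in>A. var j) * t\<^sup>2))"
proof -
  let ?m = "\<Sum>j\<in>A. mean j"
  \<comment> \<open>Replacing the target by the mean costs a factor of modulus 1, so the decay holds
    for every target.\<close>
  have "shifted_char A k t = (CLINT \<omega>|\<Omega>. iexp (t * (?m - real_of_int k)) * iexp (t * ((\<Sum>j\<in>A. real (\<eta> j \<omega>)) - ?m)))"
    unfolding shifted_char_def
    by (simp add: exp_add[symmetric] algebra_simps)
  also have "\<dots> = iexp (t * (?m - real_of_int k)) * (CLINT \<omega>|\<Omega>. iexp (t * ((\<Sum>j\<in>A. real (\<eta> j \<omega>)) - ?m)))"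
    by (rule integral_mult_right_zero)
  finally have "norm (shifted_char A k t) = norm (CLINT \<omega>|\<Omega>. iexp (t * ((\<Sum>j\<in>A. real (\<eta> j \<omega>)) - ?m)))"
    by (simp only: norm_mult norm_exp_i_times mult_1)
  also have "\<dots> \<le> exp (- (decay * (\<Sum>j\<in>A. var j) * t\<^sup>2))"
    using near_gaussian_nodes[OF A] t unfolding near_gaussian_def expectation_nodes[OF A, symmetric] variance_nodes[OF A, symmetric]
    by blast
  finally show ?thesis .
qed

lemma shifted_char_gaussian:
  assumes t: "\<bar>t\<bar> \<le> pi"
  shows "norm (shifted_char {1..N} (int (customers net)) t - of_real (exp (- ((\<Sum>j\<in>{1..N}. var j) * t\<^sup>2 / 2))))
    \<le> cubic * (\<Sum>j\<in>{1..N}. var j) * \<bar>t\<bar> ^ 3"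
proof -
  have "shifted_char {1..N} (int (customers net)) t =
      (CLINT \<omega>|\<Omega>. iexp (t * ((\<Sum>j\<in>{1..N}. real (\<eta> j \<omega>)) - (\<Sum>j\<in>{1..N}. mean j))))"
    unfolding shifted_char_def sum_mean by simp
  then show ?thesis
    using near_gaussian_nodes[OF order_refl] t
    unfolding near_gaussian_def expectation_nodes[OF order_refl, symmetric] variance_nodes[OF order_refl, symmetric]
    by simp
qed

text \<open>Only a first moment enters here, so passing from all nodes to those outside \<open>J\<close> costs a quantity
  that is negligible against the standard deviation.\<close>

lemma shifted_char_remove:
  assumes J: "J \<subseteq> {1..N}"
  shows "norm (shifted_char ({1..N} - J) (k - int m) t - shifted_char {1..N} k t)
    \<le> \<bar>t\<bar> * (real m + real (card J) * real C + load J)"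
proof -
  let ?R = "\<lambda>\<omega>. iexp (t * (real (total ({1..N} - J) \<omega>) - real_of_int (k - int m)))"
  let ?F = "\<lambda>\<omega>. iexp (t * (real (total {1..N} \<omega>) - real_of_int k))"
  note [measurable] = measurable_total[of "{1..N} - J"] measurable_total[of "{1..N}"]
  have split: "total {1..N} \<omega> = total ({1..N} - J) \<omega> + total J \<omega>" for \<omega>
    using sum.subset_diff[OF J, of "\<lambda>j. \<eta> j \<omega>"] by simp
  have intR: "integrable \<Omega> ?R" and intF: "integrable \<Omega> ?F"
    by (intro integrable_iexp; measurable)+
  have intJ: "integrable \<Omega> (\<lambda>\<omega>. \<Sum>j\<in>J. real (\<eta> j \<omega>))"
    by (intro Bochner_Integration.integrable_sum integrable_node(1)) (use J in blast)
  have "norm (shifted_char ({1..N} - J) (k - int m) t - shifted_char {1..N} k t) = norm (CLINT \<omega>|\<Omega>. ?R \<omega> - ?F \<omega>)"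
    unfolding shifted_char_def using intR intF by simp
  also have "\<dots> \<le> (\<integral>\<omega>. norm (?R \<omega> - ?F \<omega>) \<partial>\<Omega>)" by (rule integral_norm_bound)
  also have "\<dots> \<le> (\<integral>\<omega>. \<bar>t\<bar> * (real m + (\<Sum>j\<in>J. real (\<eta> j \<omega>))) \<partial>\<Omega>)"
  proof (rule integral_mono)
    show "integrable \<Omega> (\<lambda>\<omega>. norm (?R \<omega> - ?F \<omega>))" using intR intF by auto
    show "integrable \<Omega> (\<lambda>\<omega>. \<bar>t\<bar> * (real m + (\<Sum>j\<in>J. real (\<eta> j \<omega>))))" using intJ by auto
    fix \<omega>
    \<comment> \<open>Both exponents are imaginary and their difference is i t (m - total J), whence
      the Lipschitz bound for exp.\<close>
    have "norm (?R \<omega> - ?F \<omega>) \<le>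
        norm (\<i> * of_real (t * (real (total ({1..N} - J) \<omega>) - real_of_int (k - int m))) -
          \<i> * of_real (t * (real (total {1..N} \<omega>) - real_of_int k)))"
      by (rule norm_exp_diff_le) auto
    also have "\<dots> = norm (\<i> * of_real (t * (real m - real (total J \<omega>))))"
      unfolding split by (simp add: algebra_simps)
    also have "\<dots> = \<bar>t\<bar> * \<bar>real m - real (total J \<omega>)\<bar>"
      by (simp only: norm_mult norm_of_real abs_mult norm_ii mult_1)
    also have "\<dots> \<le> \<bar>t\<bar> * (real m + (\<Sum>j\<in>J. real (\<eta> j \<omega>)))"
      by (intro mult_left_mono) (auto simp: abs_le_iff sum_nonneg add_increasing)
    finally show "norm (?R \<omega> - ?F \<omega>) \<le> \<bar>t\<bar> * (real m + (\<Sum>j\<in>J. real (\<eta> j \<omega>)))" .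
  qed
  also have "\<dots> = \<bar>t\<bar> * (real m + (\<Sum>j\<in>J. mean j))"
    using intJ by (simp add: prob_space expectation_nodes[OF J])
  also have "\<dots> \<le> \<bar>t\<bar> * (real m + (real (card J) * real C + load J))"
    by (intro mult_left_mono add_left_mono sum_le_load J single(5) infinite(2)) auto
  finally show ?thesis by (simp add: add.assoc)
qed

lemma var_remove_ge:
  assumes J: "J \<subseteq> {1..N}"
  shows "(\<Sum>j\<in>{1..N} - J. var j) \<ge> (\<Sum>j\<in>{1..N}. var j) - (real (card J) * (real C)\<^sup>2 + load J)"
proof -
  have "(\<Sum>j\<in>{1..N}. var j) = (\<Sum>j\<in>{1..N} - J. var j) + (\<Sum>j\<in>J. var j)"
    by (rule sum.subset_diff[OF J]) simp
  moreover have "(\<Sum>j\<in>J. var j) \<le> real (card J) * (real C)\<^sup>2 + load J"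
    by (intro sum_le_load J single(2) infinite(3)) auto
  ultimately show ?thesis by simp
qed

section \<open>From the free variables to the product-form law\<close>

text \<open>The powers of \<gamma> collect to \<gamma>^L on states with L customers, and the
  normalising constants do not depend on f. Conditioning on the total therefore cancels both and
  leaves the product form.\<close>

lemma prob_point_eq_weight:
  assumes f: "f \<in> states net L"
  shows "prob {\<omega> \<in> space \<Omega>. \<forall>j\<in>nodes net. \<eta> j \<omega> = f j} =
    \<gamma> ^ L * state_weight net f *
    ((\<Prod>j\<in>single_server net. 1 / (\<Sum>h\<le>the_enat (capacity net j). (\<gamma> * utilization net j) ^ h)) *
     (\<Prod>j\<in>infinite_server net. exp (- (\<gamma> * utilization net j))))"
proof -
  have cap: "f j \<le> the_enat (capacity net j)" if "j \<in> single_server net" for j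
    using f that capacity_single[OF that] by (metis (mono_tags, lifting) mem_Collect_eq states_def enat_ord_simps(1))
  have "\<gamma> ^ L = (\<Prod>j\<in>nodes net. \<gamma> ^ f j)"
    using f by (auto simp: states_def power_sum[symmetric])
  also have "\<dots> = (\<Prod>j\<in>single_server net. \<gamma> ^ f j) * (\<Prod>j\<in>infinite_server net. \<gamma> ^ f j)"
    unfolding nodes_def by (rule prod.union_disjoint) (use nodes in auto)
  finally have g: "\<gamma> ^ L = (\<Prod>j\<in>single_server net. \<gamma> ^ f j) * (\<Prod>j\<in>infinite_server net. \<gamma> ^ f j)" .
  have "prob {\<omega> \<in> space \<Omega>. \<forall>j\<in>nodes net. \<eta> j \<omega> = f j} = (\<Prod>j\<in>nodes net. prob {\<omega> \<in> space \<Omega>. \<eta> j \<omega> = f j})"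
    by (rule prob_joint_point[OF indep]) (auto simp: nodes(1))
  also have "\<dots> = (\<Prod>j\<in>single_server net. prob {\<omega> \<in> space \<Omega>. \<eta> j \<omega> = f j}) * (\<Prod>j\<in>infinite_server net. prob {\<omega> \<in> space \<Omega>. \<eta> j \<omega> = f j})"
    unfolding nodes_def by (rule prod.union_disjoint) (use nodes in auto)
  also have "(\<Prod>j\<in>single_server net. prob {\<omega> \<in> space \<Omega>. \<eta> j \<omega> = f j}) =
      (\<Prod>j\<in>single_server net. (\<gamma> ^ f j * utilization net j ^ f j) * (1 / (\<Sum>h\<le>the_enat (capacity net j). (\<gamma> * utilization net j) ^ h)))"
    by (intro prod.cong refl) (simp add: law_single cap power_mult_distrib)
  also have "(\<Prod>j\<in>infinite_server net. prob {\<omega> \<in> space \<Omega>. \<eta> j \<omega> = f j}) =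
      (\<Prod>j\<in>infinite_server net. (\<gamma> ^ f j * (utilization net j ^ f j / fact (f j))) * exp (- (\<gamma> * utilization net j)))"
    by (intro prod.cong refl) (simp add: law_infinite power_mult_distrib)
  finally show ?thesis
    unfolding g state_weight_def by (simp only: prod.distrib mult_ac)
qed

text \<open>The capacity constraints hold almost surely for the free variables, so up to a null set
  only the constraint on the total remains.\<close>

lemma AE_total_iff_states:
  "AE \<omega> in \<Omega>. (\<lambda>j. if j \<in> nodes net then \<eta> j \<omega> else 0) \<in> states net L \<longleftrightarrow> int (total {1..N} \<omega>) = int L"
proof -
  have "AE \<omega> in \<Omega>. \<forall>j\<in>single_server net. \<eta> j \<omega> \<le> the_enat (capacity net j)"
    by (rule AE_finite_allI) (use single(4) nodes in auto)
  then show ?thesis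
  proof eventually_elim
    case (elim \<omega>)
    have "enat (\<eta> j \<omega>) \<le> capacity net j" if "j \<in> single_server net" for j
      using elim that capacity_single[OF that] by (metis enat_ord_simps(1))
    then have "(\<lambda>j. if j \<in> nodes net then \<eta> j \<omega> else 0) \<in> states net L \<longleftrightarrow> (\<Sum>j\<in>nodes net. \<eta> j \<omega>) = L"
      by (auto simp: states_def nodes_def)
    then show ?case by (simp only: nodes(1) of_nat_eq_iff)
  qed
qed

lemma prob_total_eq_sum:
  assumes J: "J \<subseteq> {1..N}"
  shows "prob {\<omega> \<in> space \<Omega>. (\<forall>j\<in>J. \<eta> j \<omega> = n j) \<and> int (total {1..N} \<omega>) = int L} =
    (\<Sum>f\<in>{f \<in> states net L. \<forall>j\<in>J. f j = n j}. prob {\<omega> \<in> space \<Omega>. \<forall>j\<in>nodes net. \<eta> j \<omega> = f j})"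
proof -
  have rv: "\<eta> j \<in> \<Omega> \<rightarrow>\<^sub>M count_space UNIV" if "j \<in> nodes net" for j
    using measurable_eta that by (simp add: nodes(1))
  have fin: "finite (nodes net)" by (simp add: nodes(1))
  note states = prob_states[where X = \<eta> and J = J and n = n and L = L, OF fin rv J[folded nodes(1)]]
  let ?E = "{\<omega> \<in> space \<Omega>. (\<forall>j\<in>J. \<eta> j \<omega> = n j) \<and> (\<lambda>j. if j \<in> nodes net then \<eta> j \<omega> else 0) \<in> states net L}"
  have "prob {\<omega> \<in> space \<Omega>. (\<forall>j\<in>J. \<eta> j \<omega> = n j) \<and> int (total {1..N} \<omega>) = int L} = prob ?E"
  proof (rule finite_measure_eq_AE)
    note [measurable] = measurable_total[OF order_refl]
    have "{\<omega> \<in> space \<Omega>. \<forall>j\<in>J. \<eta> j \<omega> = n j} \<in> events"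
    proof (rule sets.sets_Collect_finite_All)
      show "{\<omega> \<in> space \<Omega>. \<eta> j \<omega> = n j} \<in> events" if "j \<in> J" for j
      proof -
        have [measurable]: "\<eta> j \<in> \<Omega> \<rightarrow>\<^sub>M count_space UNIV" using measurable_eta J that by blast
        show ?thesis by measurable
      qed
    qed (use finite_subset[OF J] in auto)
    moreover have "{\<omega> \<in> space \<Omega>. int (total {1..N} \<omega>) = int L} \<in> events" by measurable
    ultimately show "{\<omega> \<in> space \<Omega>. (\<forall>j\<in>J. \<eta> j \<omega> = n j) \<and> int (total {1..N} \<omega>) = int L} \<in> events"
      by (intro sets.sets_Collect_conj)
    show "AE \<omega> in \<Omega>. \<omega> \<in> {\<omega> \<in> space \<Omega>. (\<forall>j\<in>J. \<eta> j \<omega> = n j) \<and> int (total {1..N} \<omega>) = int L} \<longleftrightarrow> \<omega> \<in> ?E"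
      using AE_total_iff_states[of L] by eventually_elim auto
    show "?E \<in> events" by (rule states(1))
  qed
  with states(2) show ?thesis by simp
qed

text \<open>Both sides equal the probability that the free variables match \<open>n\<close> on
  \<open>J\<close> and have total M: on the left the partition function cancels, on the right
  \<open>J\<close> is independent of the remaining nodes. The product form of the identity avoids
  dividing by point probabilities that may vanish.\<close>

lemma occupation_ratio:
  assumes \<xi>: "stationary_occupation net w \<Omega>' \<xi>" and J: "J \<subseteq> {1..N}"
    and pos: "prob {\<omega> \<in> space \<Omega>. int (total {1..N} \<omega>) = int (customers net)} > 0"
  shows "measure \<Omega>' {\<omega> \<in> space \<Omega>'. \<forall>j\<in>J. \<xi> j \<omega> = n j} *
      prob {\<omega> \<in> space \<Omega>. int (total {1..N} \<omega>) = int (customers net)} =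
    (\<Prod>j\<in>J. prob {\<omega> \<in> space \<Omega>. \<eta> j \<omega> = n j}) *
      prob {\<omega> \<in> space \<Omega>. int (total ({1..N} - J) \<omega>) = int (customers net) - int (\<Sum>j\<in>J. n j)}"
proof -
  interpret O': prob_space \<Omega>' using \<xi> by (simp add: stationary_occupation_def)
  let ?M = "customers net" and ?Z = "partition_function net"
  let ?T = "{f \<in> states net ?M. \<forall>j\<in>J. f j = n j}"
  have fin: "finite (nodes net)" by (simp add: nodes(1))
  have rv: "\<xi> j \<in> \<Omega>' \<rightarrow>\<^sub>M count_space UNIV" if "j \<in> nodes net" for j
    using \<xi> that by (simp add: stationary_occupation_def)
  have law: "O'.prob {\<omega> \<in> space \<Omega>'. \<forall>j\<in>nodes net. \<xi> j \<omega> = f j} = state_weight net f / ?Z"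
    if "f \<in> states net ?M" for f
    using \<xi> that by (simp add: stationary_occupation_def)
  obtain D where D: "prob {\<omega> \<in> space \<Omega>. \<forall>j\<in>nodes net. \<eta> j \<omega> = f j} = \<gamma> ^ ?M * state_weight net f * D"
    if "f \<in> states net ?M" for f
    using prob_point_eq_weight by blast
  let ?S = "{\<omega> \<in> space \<Omega>. int (total {1..N} \<omega>) = int ?M}"
  have "prob ?S = (\<Sum>f\<in>states net ?M. \<gamma> ^ ?M * state_weight net f * D)"
    using prob_total_eq_sum[where J = "{}" and n = n and L = ?M] D by simp
  then have S: "prob ?S = \<gamma> ^ ?M * ?Z * D"
    by (simp add: partition_function_def sum_distrib_left sum_distrib_right)
  have E: "prob {\<omega> \<in> space \<Omega>. (\<forall>j\<in>J. \<eta> j \<omega> = n j) \<and> int (total {1..N} \<omega>) = int ?M} =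
      \<gamma> ^ ?M * (\<Sum>f\<in>?T. state_weight net f) * D"
    unfolding prob_total_eq_sum[OF J] by (simp add: D sum_distrib_left sum_distrib_right)
  \<comment> \<open>The partition function is a factor of a probability assumed positive.\<close>
  have Z: "?Z \<noteq> 0" using S pos by auto
  let ?vec = "\<lambda>\<omega> j. if j \<in> nodes net then \<xi> j \<omega> else 0"
  \<comment> \<open>The point masses on the state space already sum to 1, so the stationary vector
    lies there almost surely.\<close>
  have "O'.prob {\<omega> \<in> space \<Omega>'. ?vec \<omega> \<in> states net ?M} = (\<Sum>f\<in>states net ?M. state_weight net f / ?Z)"
    using O'.prob_states(2)[where X = \<xi> and J = "{}" and n = n and L = ?M, OF fin rv empty_subsetI] law by simp
  also have "\<dots> = 1" using Z by (simp add: sum_divide_distrib[symmetric] partition_function_def)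
  finally have AE: "AE \<omega> in \<Omega>'. ?vec \<omega> \<in> states net ?M"
    using O'.prob_states(1)[where X = \<xi> and J = "{}" and n = n and L = ?M, OF fin rv empty_subsetI] by (subst (asm) O'.prob_Collect_eq_1) auto
  note statesJ = O'.prob_states[where X = \<xi> and J = J and n = n and L = ?M, OF fin rv J[folded nodes(1)]]
  have "O'.prob {\<omega> \<in> space \<Omega>'. \<forall>j\<in>J. \<xi> j \<omega> = n j} =
      O'.prob {\<omega> \<in> space \<Omega>'. (\<forall>j\<in>J. \<xi> j \<omega> = n j) \<and> ?vec \<omega> \<in> states net ?M}"
  proof (rule O'.finite_measure_eq_AE)
    show "{\<omega> \<in> space \<Omega>'. \<forall>j\<in>J. \<xi> j \<omega> = n j} \<in> O'.events"
      using J finite_subset[OF J] rv nodes(1) by (auto intro!: sets.sets_Collect_finite_All)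
    show "AE \<omega> in \<Omega>'. \<omega> \<in> {\<omega> \<in> space \<Omega>'. \<forall>j\<in>J. \<xi> j \<omega> = n j} \<longleftrightarrow>
        \<omega> \<in> {\<omega> \<in> space \<Omega>'. (\<forall>j\<in>J. \<xi> j \<omega> = n j) \<and> ?vec \<omega> \<in> states net ?M}"
      using AE by eventually_elim auto
  qed (rule statesJ(1))
  also have "\<dots> = (\<Sum>f\<in>?T. state_weight net f / ?Z)" by (subst statesJ(2)) (simp_all add: law)
  finally have "O'.prob {\<omega> \<in> space \<Omega>'. \<forall>j\<in>J. \<xi> j \<omega> = n j} * prob ?S =
      prob {\<omega> \<in> space \<Omega>. (\<forall>j\<in>J. \<eta> j \<omega> = n j) \<and> int (total {1..N} \<omega>) = int ?M}"
    unfolding S E using Z by (simp add: sum_divide_distrib[symmetric])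
  also have "{\<omega> \<in> space \<Omega>. (\<forall>j\<in>J. \<eta> j \<omega> = n j) \<and> int (total {1..N} \<omega>) = int ?M} =
      {\<omega> \<in> space \<Omega>. (\<forall>j\<in>J. \<eta> j \<omega> = n j) \<and> int (total ({1..N} - J) \<omega>) = int ?M - int (\<Sum>j\<in>J. n j)}"
  proof -
    have "int (total {1..N} \<omega>) = int ?M \<longleftrightarrow> int (total ({1..N} - J) \<omega>) = int ?M - int (\<Sum>j\<in>J. n j)"
      if "\<forall>j\<in>J. \<eta> j \<omega> = n j" for \<omega>
    proof -
      have "total {1..N} \<omega> = total ({1..N} - J) \<omega> + total J \<omega>"
        by (rule sum.subset_diff[OF J]) simp
      moreover have "total J \<omega> = (\<Sum>j\<in>J. n j)" using that by (intro sum.cong) auto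
      ultimately show ?thesis by (simp add: eq_diff_eq)
    qed
    then show ?thesis by blast
  qed
  also have "prob \<dots> = (\<Prod>j\<in>J. prob {\<omega> \<in> space \<Omega>. \<eta> j \<omega> = n j}) *
      prob {\<omega> \<in> space \<Omega>. int (total ({1..N} - J) \<omega>) = int ?M - int (\<Sum>j\<in>J. n j)}"
    unfolding prob_point_and_sum[OF indep finite_atLeastAtMost J]
    using prob_joint_point[OF indep finite_subset[OF J finite_atLeastAtMost] J] by simp
  finally show ?thesis .
qed

lemma prob_node_pos:
  assumes \<gamma>: "\<gamma> > 0" and j: "j \<in> {1..N}" and cap: "\<not> enat k > capacity net j"
  shows "prob {\<omega> \<in> space \<Omega>. \<eta> j \<omega> = k} > 0"
proof -
  have x: "\<gamma> * utilization net j > 0" using \<gamma> utilization[of j] j by (simp add: nodes(1))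
  consider "j \<in> single_server net" | "j \<in> infinite_server net" using node_cases[OF j] by blast
  then show ?thesis
  proof cases
    case 1
    then have "k \<le> the_enat (capacity net j)"
      using cap capacity_single[OF 1] by (metis enat_ord_simps(1) not_less)
    moreover have "(\<Sum>h\<le>the_enat (capacity net j). (\<gamma> * utilization net j) ^ h) > 0"
      by (rule sum_pos) (use x in auto)
    ultimately show ?thesis using law_single[OF 1] x by simp
  next
    case 2
    then show ?thesis using law_infinite[OF 2] x by simp
  qed
qed

end

section \<open>Asymptotic independence\<close>

theorem theorem4p2:
  fixes net :: "nat \<Rightarrow> jackson_network"
    and w :: "nat \<Rightarrow> nat \<Rightarrow> nat \<Rightarrow> (nat \<Rightarrow> nat) \<Rightarrow> real"
    and \<Omega> :: "nat \<Rightarrow> 'a measure" and \<xi> :: "nat \<Rightarrow> nat \<Rightarrow> 'a \<Rightarrow> nat"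
    and \<Omega>' :: "nat \<Rightarrow> 'b measure" and \<eta> :: "nat \<Rightarrow> nat \<Rightarrow> 'b \<Rightarrow> nat"
    and \<gamma> b :: "nat \<Rightarrow> real" and C :: real and K :: nat and n :: "nat \<Rightarrow> nat"
  assumes network: "\<And>N. N \<ge> 2 \<Longrightarrow> network_on N (net N)"
    and dynamics: "\<And>N. N \<ge> 2 \<Longrightarrow>
      blocking (net N) (w N) \<or> blocking_rerouting (net N) (w N) \<or>
      state_dependent_routing (net N) (w N)"
    and xi: "\<And>N. N \<ge> 2 \<Longrightarrow> stationary_occupation (net N) (w N) (\<Omega> N) (\<xi> N)"
    and gamma: "\<And>N. N \<ge> 2 \<Longrightarrow> chemical_potential (net N) (\<gamma> N)"
    and eta: "\<And>N. N \<ge> 2 \<Longrightarrow> free_variables (net N) (\<gamma> N) (\<Omega>' N) (\<eta> N)"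
    and b: "\<And>N. N \<ge> 2 \<Longrightarrow> b N \<ge> 0 \<and>
      (b N)\<^sup>2 = prob_space.variance (\<Omega>' N) (\<lambda>\<omega>. \<Sum>j\<in>{1..N}. real (\<eta> N j \<omega>))"
    and bounded_capacities:
      "\<And>N j. N \<ge> 2 \<Longrightarrow> j \<in> single_server (net N) \<Longrightarrow> real (the_enat (capacity (net N) j)) \<le> C"
    and b_infinity: "filterlim b at_top sequentially"
    and K: "K \<ge> 1"
    and negligible:
      "(\<lambda>N. (\<Sum>j\<in>infinite_server (net N) \<inter> {1..K}. \<gamma> N * utilization (net N) j) / b N)
         \<longlonglongrightarrow> 0"
  shows "(\<lambda>N. if \<exists>j\<in>{1..K}. enat (n j) > capacity (net N) j then 1
           else measure (\<Omega> N) {\<omega> \<in> space (\<Omega> N). \<forall>j\<in>{1..K}. \<xi> N j \<omega> = n j} /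
                (\<Prod>j\<in>{1..K}. measure (\<Omega>' N) {\<omega> \<in> space (\<Omega>' N). \<eta> N j \<omega> = n j}))
         \<longlonglongrightarrow> 1"
proof -
  \<comment> \<open>Finite capacities are integers, so the real bound C may be rounded down to a
    natural number.\<close>
  define D where "D = nat \<lfloor>C\<rfloor>"
  define m where "m = (\<Sum>j\<in>{1..K}. n j)"
  define M where "M N = int (customers (net N))" for N
  define S where "S A N \<omega> = (\<Sum>j\<in>A. \<eta> N j \<omega>)" for A N \<omega>
  define p where "p N = measure (\<Omega>' N) {\<omega> \<in> space (\<Omega>' N). int (S {1..N} N \<omega>) = M N}" for N
  define q where "q N = measure (\<Omega>' N) {\<omega> \<in> space (\<Omega>' N). int (S ({1..N} - {1..K}) N \<omega>) = M N - int m}" for N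
  define f where "f N t = (CLINT \<omega>|\<Omega>' N. iexp (t * (real (S {1..N} N \<omega>) - real_of_int (M N))))" for N t
  define g where "g N t = (CLINT \<omega>|\<Omega>' N. iexp (t * (real (S ({1..N} - {1..K}) N \<omega>) - real_of_int (M N - int m))))" for N t
  define l where "l N = (\<Sum>j\<in>infinite_server (net N) \<inter> {1..K}. \<gamma> N * utilization (net N) j)" for N
  define a where "a = 1 / (pi\<^sup>2 * real (D + 1) ^ 4)"
  define B where "B = 1 / 6 + real D / 6 + (real D)\<^sup>2 * pi / 8"
  have a: "a > 0" by (simp add: a_def zero_less_mult_iff)
  have closed: "closed_network (net N) N (\<gamma> N) (\<Omega>' N) (\<eta> N) D" if "N \<ge> 2" for N
  proof
    show "network_on N (net N)" "chemical_potential (net N) (\<gamma> N)" "free_variables (net N) (\<gamma> N) (\<Omega>' N) (\<eta> N)"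
      using network gamma eta that by auto
    show "utilization (net N) j > 0" if "j \<in> nodes (net N)" for j
      using utilization_pos[OF network dynamics that] \<open>N \<ge> 2\<close> by blast
    show "the_enat (capacity (net N) j) \<le> D" if "j \<in> single_server (net N)" for j
      using bounded_capacities[OF \<open>N \<ge> 2\<close> that] by (simp add: D_def le_nat_floor)
  qed
  have large: "\<forall>\<^sub>F N in sequentially. N \<ge> 2 \<and> N \<ge> K"
    using eventually_ge_at_top[of "max 2 K"] by eventually_elim auto
  have bpos: "\<forall>\<^sub>F N in sequentially. b N > 0"
    using b_infinity by (simp add: filterlim_at_top_dense)
  have facts: "(b N)\<^sup>2 = (\<Sum>j\<in>{1..N}. prob_space.variance (\<Omega>' N) (\<lambda>\<omega>. real (\<eta> N j \<omega>)))"
    "(CLINT t:{-pi..pi}|lborel. f N t) = of_real (2 * pi * p N)"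
    "f N \<in> borel_measurable borel"
    "\<And>t. \<bar>t\<bar> \<le> pi \<Longrightarrow> norm (f N t) \<le> exp (- (a * (b N)\<^sup>2 * t\<^sup>2))"
    "\<And>t. \<bar>t\<bar> \<le> pi \<Longrightarrow> norm (f N t - of_real (exp (- ((b N)\<^sup>2 * t\<^sup>2 / 2)))) \<le> B * (b N)\<^sup>2 * \<bar>t\<bar> ^ 3"
    if "N \<ge> 2" for N
  proof -
    interpret closed_network "net N" N "\<gamma> N" "\<Omega>' N" "\<eta> N" D by (rule closed[OF that])
    show b': "(b N)\<^sup>2 = (\<Sum>j\<in>{1..N}. var j)"
      using b[OF that] variance_nodes[OF order_refl] by simp
    have f: "f N = shifted_char {1..N} (M N)"
      by (simp add: fun_eq_iff f_def shifted_char_def S_def)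
    show "(CLINT t:{-pi..pi}|lborel. f N t) = of_real (2 * pi * p N)"
      unfolding f p_def S_def by (rule integral_shifted_char) simp
    show "f N \<in> borel_measurable borel" unfolding f by (rule measurable_shifted_char) simp
    show "norm (f N t) \<le> exp (- (a * (b N)\<^sup>2 * t\<^sup>2))" if "\<bar>t\<bar> \<le> pi" for t
      unfolding f a_def b' by (rule norm_shifted_char_le[OF order_refl that])
    show "norm (f N t - of_real (exp (- ((b N)\<^sup>2 * t\<^sup>2 / 2)))) \<le> B * (b N)\<^sup>2 * \<bar>t\<bar> ^ 3" if "\<bar>t\<bar> \<le> pi" for t
      unfolding f B_def b' M_def by (rule shifted_char_gaussian[OF that])
  qed
  have factsK: "(CLINT t:{-pi..pi}|lborel. g N t) = of_real (2 * pi * q N)"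
    "g N \<in> borel_measurable borel"
    "\<And>t. \<bar>t\<bar> \<le> pi \<Longrightarrow> norm (g N t) \<le> exp (- (a * ((b N)\<^sup>2 - (real K * (real D)\<^sup>2 + l N)) * t\<^sup>2))"
    "\<And>t. norm (g N t - f N t) \<le> \<bar>t\<bar> * (real m + real K * real D + l N)"
    "l N \<ge> 0"
    if N: "N \<ge> 2 \<and> N \<ge> K" for N
  proof -
    interpret closed_network "net N" N "\<gamma> N" "\<Omega>' N" "\<eta> N" D by (rule closed) (use N in simp)
    have J: "{1..K} \<subseteq> {1..N}" using N by auto
    have l: "l N = load {1..K}" by (simp add: l_def load_def)
    have f: "f N = shifted_char {1..N} (M N)"
      by (simp add: fun_eq_iff f_def shifted_char_def S_def)
    have g: "g N = shifted_char ({1..N} - {1..K}) (M N - int m)"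
      by (simp add: fun_eq_iff g_def shifted_char_def S_def)
    show "(CLINT t:{-pi..pi}|lborel. g N t) = of_real (2 * pi * q N)"
      unfolding g q_def S_def by (rule integral_shifted_char) auto
    show "g N \<in> borel_measurable borel" unfolding g by (rule measurable_shifted_char) auto
    show "l N \<ge> 0" unfolding l by (rule load_ge_0)
    show "norm (g N t - f N t) \<le> \<bar>t\<bar> * (real m + real K * real D + l N)" for t
      using shifted_char_remove[OF J, of "M N" m t] by (simp add: f g l)
    show "norm (g N t) \<le> exp (- (a * ((b N)\<^sup>2 - (real K * (real D)\<^sup>2 + l N)) * t\<^sup>2))" if t: "\<bar>t\<bar> \<le> pi" for t
    proof -
      have "norm (g N t) \<le> exp (- (a * (\<Sum>j\<in>{1..N} - {1..K}. var j) * t\<^sup>2))"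
        unfolding g a_def by (rule norm_shifted_char_le[OF _ t]) auto
      also have "a * ((b N)\<^sup>2 - (real K * (real D)\<^sup>2 + l N)) * t\<^sup>2 \<le> a * (\<Sum>j\<in>{1..N} - {1..K}. var j) * t\<^sup>2"
        using var_remove_ge[OF J] a facts(1)[of N] N by (intro mult_right_mono mult_left_mono) (auto simp: l)
      then have "exp (- (a * (\<Sum>j\<in>{1..N} - {1..K}. var j) * t\<^sup>2)) \<le> exp (- (a * ((b N)\<^sup>2 - (real K * (real D)\<^sup>2 + l N)) * t\<^sup>2))"
        by simp
      finally show ?thesis .
    qed
  qed
  have small: "(\<lambda>N. c / b N) \<longlonglongrightarrow> 0" for c
    using b_infinity by (rule real_tendsto_divide_at_top[OF tendsto_const])
  have l0: "(\<lambda>N. l N / b N) \<longlonglongrightarrow> 0" using negligible unfolding l_def .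
  have in_range: "\<forall>\<^sub>F N in sequentially. \<bar>u / b N\<bar> \<le> pi" for u
  proof -
    have "\<forall>\<^sub>F N in sequentially. u / b N \<in> {-pi<..<pi}"
      by (rule topological_tendstoD[OF small]) auto
    then show ?thesis by eventually_elim auto
  qed
  have f_lim: "(\<lambda>N. f N (u / b N)) \<longlonglongrightarrow> of_real (exp (- (u\<^sup>2 / 2)))" for u
  proof -
    \<comment> \<open>At t = u / b the cubic error B b^2 \<bar>t\<bar>^3 becomes B \<bar>u\<bar>^3 /
      b, of order 1 / b.\<close>
    have "\<forall>\<^sub>F N in sequentially. norm (f N (u / b N) - of_real (exp (- (u\<^sup>2 / 2)))) \<le> B * \<bar>u\<bar> ^ 3 / b N"
      using large bpos in_range[of u]
    proof eventually_elim
      case (elim N)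
      have "(b N)\<^sup>2 * (u / b N)\<^sup>2 = u\<^sup>2" "B * (b N)\<^sup>2 * \<bar>u / b N\<bar> ^ 3 = B * \<bar>u\<bar> ^ 3 / b N"
        using elim by (auto simp: power_divide power2_eq_square power3_eq_cube)
      with facts(5)[of N "u / b N"] elim show ?case by simp
    qed
    then have "(\<lambda>N. f N (u / b N) - of_real (exp (- (u\<^sup>2 / 2)))) \<longlonglongrightarrow> 0"
      by (rule Lim_null_comparison[OF _ small])
    then show ?thesis by (simp add: LIM_zero_iff)
  qed
  have g_lim: "(\<lambda>N. g N (u / b N)) \<longlonglongrightarrow> of_real (exp (- (u\<^sup>2 / 2)))" for u
  proof -
    \<comment> \<open>The factor 1 / b from t = u / b meets a constant plus the load of the first K
      nodes; the negligibility assumption makes the quotient vanish.\<close>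
    have "\<forall>\<^sub>F N in sequentially. norm (g N (u / b N) - f N (u / b N)) \<le> \<bar>u\<bar> * ((real m + real K * real D) / b N + l N / b N)"
      using large bpos
    proof eventually_elim
      case (elim N)
      then show ?case using factsK(4)[of N "u / b N"] by (simp add: add_divide_distrib distrib_left)
    qed
    moreover have "(\<lambda>N. \<bar>u\<bar> * ((real m + real K * real D) / b N + l N / b N)) \<longlonglongrightarrow> 0"
      by (intro tendsto_mult_right_zero tendsto_add_zero small l0)
    ultimately have "(\<lambda>N. g N (u / b N) - f N (u / b N)) \<longlonglongrightarrow> 0"
      by (rule Lim_null_comparison)
    from tendsto_add[OF this f_lim[of u]] show ?thesis by simp
  qed
  have p_lim: "(\<lambda>N. b N * p N) \<longlonglongrightarrow> 1 / sqrt (2 * pi)"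
  proof (rule local_limit_from_char[OF b_infinity a _ _ _ f_lim])
    show "\<forall>\<^sub>F N in sequentially. (CLINT t:{-pi..pi}|lborel. f N t) = of_real (2 * pi * p N)"
      using large by eventually_elim (use facts(2) in blast)
    show "\<forall>\<^sub>F N in sequentially. f N \<in> borel_measurable borel"
      using large by eventually_elim (use facts(3) in blast)
    show "\<forall>\<^sub>F N in sequentially. \<forall>t\<in>{-pi..pi}. norm (f N t) \<le> exp (- (a * (b N)\<^sup>2 * t\<^sup>2))"
      using large by eventually_elim (use facts(4) in auto)
  qed
  have q_lim: "(\<lambda>N. b N * q N) \<longlonglongrightarrow> 1 / sqrt (2 * pi)"
  proof (rule local_limit_from_char[OF b_infinity _ _ _ _ g_lim])
    \<comment> \<open>The rate is halved because S' is normalised by \<open>b\<close>, the standard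
      deviation of S: eventually its variance is at least b^2 / 2.\<close>
    show "a / 2 > 0" using a by simp
    show "\<forall>\<^sub>F N in sequentially. (CLINT t:{-pi..pi}|lborel. g N t) = of_real (2 * pi * q N)"
      using large by eventually_elim (use factsK(1) in blast)
    show "\<forall>\<^sub>F N in sequentially. g N \<in> borel_measurable borel"
      using large by eventually_elim (use factsK(2) in blast)
    have "(\<lambda>N. real K * (real D)\<^sup>2 / b N + l N / b N) \<longlonglongrightarrow> 0"
      by (intro tendsto_add_zero small l0)
    then have "\<forall>\<^sub>F N in sequentially. real K * (real D)\<^sup>2 / b N + l N / b N < 1"
      by (rule order_tendstoD) simp
    moreover have "\<forall>\<^sub>F N in sequentially. b N \<ge> 2"
      using b_infinity by (simp add: filterlim_at_top)
    ultimately show "\<forall>\<^sub>F N in sequentially. \<forall>t\<in>{-pi..pi}. norm (g N t) \<le> exp (- (a / 2 * (b N)\<^sup>2 * t\<^sup>2))"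
      using large
    proof eventually_elim
      case (elim N)
      have "(real K * (real D)\<^sup>2 + l N) / b N < 1" using elim by (simp add: add_divide_distrib)
      then have "real K * (real D)\<^sup>2 + l N \<le> b N" using elim by (simp add: divide_simps)
      \<comment> \<open>The variance lost is of smaller order than b, hence eventually at most b,
        and b \<ge> 2 makes this at most b^2 / 2.\<close>
      also have "b N \<le> (b N)\<^sup>2 / 2" using elim by (simp add: power2_eq_square)
      finally have half: "(b N)\<^sup>2 / 2 \<le> (b N)\<^sup>2 - (real K * (real D)\<^sup>2 + l N)" by linarith
      show ?case
      proof
        fix t assume t: "t \<in> {-pi..pi}"
        have "norm (g N t) \<le> exp (- (a * ((b N)\<^sup>2 - (real K * (real D)\<^sup>2 + l N)) * t\<^sup>2))"
          by (rule factsK(3)) (use elim t in auto)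
        also have "a / 2 * (b N)\<^sup>2 * t\<^sup>2 \<le> a * ((b N)\<^sup>2 - (real K * (real D)\<^sup>2 + l N)) * t\<^sup>2"
        proof -
          have "a * ((b N)\<^sup>2 / 2) * t\<^sup>2 \<le> a * ((b N)\<^sup>2 - (real K * (real D)\<^sup>2 + l N)) * t\<^sup>2"
            by (intro mult_right_mono mult_left_mono half) (use a in auto)
          then show ?thesis by (simp only: times_divide_eq_left times_divide_eq_right)
        qed
        then have "exp (- (a * ((b N)\<^sup>2 - (real K * (real D)\<^sup>2 + l N)) * t\<^sup>2)) \<le> exp (- (a / 2 * (b N)\<^sup>2 * t\<^sup>2))"
          by (simp only: exp_le_cancel_iff neg_le_iff_le)
        finally show "norm (g N t) \<le> exp (- (a / 2 * (b N)\<^sup>2 * t\<^sup>2))" .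
      qed
    qed
  qed
  have ppos: "\<forall>\<^sub>F N in sequentially. p N > 0"
  proof -
    have "\<forall>\<^sub>F N in sequentially. b N * p N > 0"
      by (rule order_tendstoD(1)[OF p_lim]) simp
    with bpos show ?thesis by eventually_elim (simp add: zero_less_mult_iff)
  qed
  have "(\<lambda>N. (b N * q N) / (b N * p N)) \<longlonglongrightarrow> (1 / sqrt (2 * pi)) / (1 / sqrt (2 * pi))"
    by (rule tendsto_divide[OF q_lim p_lim]) simp
  moreover have "\<forall>\<^sub>F N in sequentially. (b N * q N) / (b N * p N) = q N / p N"
    using bpos by eventually_elim simp
  ultimately have "(\<lambda>N. q N / p N) \<longlonglongrightarrow> (1 / sqrt (2 * pi)) / (1 / sqrt (2 * pi))"
    by (rule Lim_transform_eventually)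
  moreover have "(1 / sqrt (2 * pi)) / (1 / sqrt (2 * pi)) = 1"
    by (rule divide_self) simp
  ultimately have ratio: "(\<lambda>N. q N / p N) \<longlonglongrightarrow> 1" by (simp only:)
  let ?R = "\<lambda>N. if \<exists>j\<in>{1..K}. enat (n j) > capacity (net N) j then 1
           else measure (\<Omega> N) {\<omega> \<in> space (\<Omega> N). \<forall>j\<in>{1..K}. \<xi> N j \<omega> = n j} /
                (\<Prod>j\<in>{1..K}. measure (\<Omega>' N) {\<omega> \<in> space (\<Omega>' N). \<eta> N j \<omega> = n j})"
  \<comment> \<open>The two branches may alternate with N. When a capacity is exceeded the left side
    is 0; otherwise the ratio equals q N / p N. One inequality covers both.\<close>
  have "\<forall>\<^sub>F N in sequentially. norm (?R N - 1) \<le> norm (q N / p N - 1)"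
    using large bpos ppos
  proof eventually_elim
    case (elim N)
    interpret closed_network "net N" N "\<gamma> N" "\<Omega>' N" "\<eta> N" D by (rule closed) (use elim in simp)
    have J: "{1..K} \<subseteq> {1..N}" using elim by auto
    show ?case
    proof (cases "\<exists>j\<in>{1..K}. enat (n j) > capacity (net N) j")
      case False
      have "(\<Sum>j\<in>{1..N}. var j) > 0"
        by (subst facts(1)[symmetric]) (use elim in auto)
      then have "\<gamma> N > 0" by (rule gamma_pos)
      then have "(\<Prod>j\<in>{1..K}. prob {\<omega> \<in> space (\<Omega>' N). \<eta> N j \<omega> = n j}) > 0"
        using False J by (intro prod_pos ballI prob_node_pos) auto
      moreover have "measure (\<Omega> N) {\<omega> \<in> space (\<Omega> N). \<forall>j\<in>{1..K}. \<xi> N j \<omega> = n j} * p N =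
          (\<Prod>j\<in>{1..K}. prob {\<omega> \<in> space (\<Omega>' N). \<eta> N j \<omega> = n j}) * q N"
        using occupation_ratio[OF xi J, of n] elim unfolding p_def q_def S_def M_def m_def by blast
      moreover have "x / d = q N / p N" if "d > 0" "x * p N = d * q N" for x d :: real
        using that elim by (simp add: field_simps)
      ultimately have "measure (\<Omega> N) {\<omega> \<in> space (\<Omega> N). \<forall>j\<in>{1..K}. \<xi> N j \<omega> = n j} /
          (\<Prod>j\<in>{1..K}. prob {\<omega> \<in> space (\<Omega>' N). \<eta> N j \<omega> = n j}) = q N / p N" by blast
      then show ?thesis by (simp only: False if_False order_refl)
    qed simp
  qed
  moreover have "(\<lambda>N. norm (q N / p N - 1)) \<longlonglongrightarrow> 0"
    by (rule tendsto_norm_zero[OF LIM_zero[OF ratio]])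
  ultimately have "(\<lambda>N. ?R N - 1) \<longlonglongrightarrow> 0" by (rule Lim_null_comparison)
  then show ?thesis by (simp only: LIM_zero_iff)
qed

end
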